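(* Let $k\ge 3$. If $G$ is a finite $k$-regular graph with (vertex) connectivity $2$, then $G$ is $k$-swappable.
   Context: A list-assignment $L$ assigns to each vertex $v$ a set $L(v)$ of colors; an $L$-coloring is a proper coloring $\varphi$ with $\varphi(v)\in L(v)$. An $\alpha,\beta$-Kempe swap at a vertex $u$ with $\varphi(u)\in\{\alpha,\beta\}$ interchanges $\alpha$ and $\beta$ on the component containing $u$ of the subgraph induced by vertices colored $\alpha$ or $\beta$; it is $L$-valid if the result is again an $L$-coloring. Two $L$-colorings are $L$-equivalent if one is obtained from the other by a sequence of $L$-valid Kempe swaps. $G$ is $L$-swappable if it has an $L$-coloring and all its $L$-colorings are pairwise $L$-equivalent. A $k$-assignment has $|L(v)|=k$ for all $v$; $G$ is $k$-swappable if it is $L$-swappable for every $k$-assignment $L$. *)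

theory Defs
  imports
    "Graph_Theory.Digraph_Component"
    "HOL-Library.FuncSet"
    "HOL-Combinatorics.Transposition"
begin

text \<open>
  A finite simple graph is an instance of the locale \<open>graph\<close> (a finite symmetric digraph without
  loops and parallel arcs), so the degree of a vertex is its out-degree.
\<close>

definition regular :: "nat \<Rightarrow> ('a, 'b) pre_digraph \<Rightarrow> bool" where
  "regular k G \<longleftrightarrow> (\<forall>v\<in>verts G. out_degree G v = k)"

text \<open>
  The minimum size of a vertex set whose deletion leaves a disconnected graph or a single vertex.
  The empty graph is not \<^const>\<open>connected\<close>, but deleting all vertices is never optimal unless the
  graph is already empty.
\<close>

definition vertex_connectivity :: "('a, 'b) pre_digraph \<Rightarrow> nat" where
  "vertex_connectivity G = (LEAST n. \<exists>S\<subseteq>verts G. card S = n \<and>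
     (\<not> connected (G \<restriction> (verts G - S)) \<or> card (verts G - S) = 1))"

text \<open>
  Colorings are functions on the vertex set only: outside \<^term>\<open>verts G\<close> they are
  \<^const>\<open>undefined\<close>, so that equality of colorings is equality on the vertices.
\<close>

definition list_coloring :: "('a, 'b) pre_digraph \<Rightarrow> ('a \<Rightarrow> 'c set) \<Rightarrow> ('a \<Rightarrow> 'c) \<Rightarrow> bool" where
  "list_coloring G L \<phi> \<longleftrightarrow>
     \<phi> \<in> (\<Pi>\<^sub>E v\<in>verts G. L v) \<and> (\<forall>u v. u \<rightarrow>\<^bsub>G\<^esub> v \<longrightarrow> \<phi> u \<noteq> \<phi> v)"

definition kempe_component ::
    "('a, 'b) pre_digraph \<Rightarrow> ('a \<Rightarrow> 'c) \<Rightarrow> 'c \<Rightarrow> 'c \<Rightarrow> 'a \<Rightarrow> 'a set" where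
  "kempe_component G \<phi> \<alpha> \<beta> u =
     {v. u \<rightarrow>\<^sup>*\<^bsub>G \<restriction> {w \<in> verts G. \<phi> w = \<alpha> \<or> \<phi> w = \<beta>}\<^esub> v}"

definition kempe_swap ::
    "('a, 'b) pre_digraph \<Rightarrow> 'c \<Rightarrow> 'c \<Rightarrow> 'a \<Rightarrow> ('a \<Rightarrow> 'c) \<Rightarrow> 'a \<Rightarrow> 'c" where
  "kempe_swap G \<alpha> \<beta> u \<phi> =
     (\<lambda>v. if v \<in> kempe_component G \<phi> \<alpha> \<beta> u then transpose \<alpha> \<beta> (\<phi> v) else \<phi> v)"

definition valid_kempe_step ::
    "('a, 'b) pre_digraph \<Rightarrow> ('a \<Rightarrow> 'c set) \<Rightarrow> ('a \<Rightarrow> 'c) \<Rightarrow> ('a \<Rightarrow> 'c) \<Rightarrow> bool" where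
  "valid_kempe_step G L \<phi> \<psi> \<longleftrightarrow> list_coloring G L \<phi> \<and> list_coloring G L \<psi> \<and>
     (\<exists>\<alpha> \<beta>. \<exists>u\<in>verts G. \<alpha> \<noteq> \<beta> \<and> \<phi> u \<in> {\<alpha>, \<beta>} \<and> \<psi> = kempe_swap G \<alpha> \<beta> u \<phi>)"

definition list_equivalent ::
    "('a, 'b) pre_digraph \<Rightarrow> ('a \<Rightarrow> 'c set) \<Rightarrow> ('a \<Rightarrow> 'c) \<Rightarrow> ('a \<Rightarrow> 'c) \<Rightarrow> bool" where
  "list_equivalent G L = (valid_kempe_step G L)\<^sup>*\<^sup>*"

definition list_swappable :: "('a, 'b) pre_digraph \<Rightarrow> ('a \<Rightarrow> 'c set) \<Rightarrow> bool" where
  "list_swappable G L \<longleftrightarrow> (\<exists>\<phi>. list_coloring G L \<phi>) \<and>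
     (\<forall>\<phi> \<psi>. list_coloring G L \<phi> \<longrightarrow> list_coloring G L \<psi> \<longrightarrow> list_equivalent G L \<phi> \<psi>)"

definition list_assignment :: "nat \<Rightarrow> ('a, 'b) pre_digraph \<Rightarrow> ('a \<Rightarrow> 'c set) \<Rightarrow> bool" where
  "list_assignment k G L \<longleftrightarrow> (\<forall>v\<in>verts G. finite (L v) \<and> card (L v) = k)"

text \<open>The type of colors is an explicit argument, so that lists over any type are covered.\<close>

definition swappable :: "'c itself \<Rightarrow> nat \<Rightarrow> ('a, 'b) pre_digraph \<Rightarrow> bool" where
  "swappable _ k G \<longleftrightarrow> (\<forall>L :: 'a \<Rightarrow> 'c set. list_assignment k G L \<longrightarrow> list_swappable G L)"

end

theory Submission
  imports Defs "HOL-Combinatorics.Permutations"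
begin

text \<open>
  If every list is at least as large as the degree and every component has a vertex where it is
  larger, then all list colorings are equivalent: delete such a vertex and lift the swaps. Hence in a
  \<open>k\<close>-regular graph without cutvertices all colorings giving \<open>u\<close> the color \<open>c\<close> are equivalent as soon
  as some neighbor of \<open>u\<close> lacks \<open>c\<close>; call \<open>(u, c)\<close> a good pair. If the lists are not all equal,
  every coloring is equivalent to one that realizes a good pair, and it remains to link the good pairs.

  Let \<open>W\<close> be an inclusion-minimal union of components left by a separating pair \<open>{x, y}\<close>; its vertices
  lie in no separating pair. If the lists are constant on \<open>W \<union> {x, y}\<close>, then \<open>W\<close> can be replaced by
  an edge (or \<open>W\<close> forces \<open>x\<close> and \<open>y\<close> to have the same color, and \<open>W\<close> and \<open>y\<close> can be suppressed); the
  smaller graph has slack and its swaps lift. Otherwise there are two such sets \<open>W\<close>, each containing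
  good pairs, and these are linked to each other and to all others.

  If all lists are equal, the swaps of each side of the separating pair, with the edge \<open>xy\<close> added,
  lift up to a permutation of the colors on the other side.
\<close>

text \<open>With lists exactly as large as the degrees, no vertex is sure to have a free color, and
  a swap is invalid as soon as a list along its Kempe component lacks one of the two colors. Each
  case therefore has to produce a vertex with a color to spare: a neighbor of a precolored vertex
  whose list lacks that color, or a vertex that loses at least two neighbors with a removed side and
  gains one by an added edge. Two good pairs are linked by a coloring that realizes both.
  Precoloring both vertices keeps the argument alive only if deleting both leaves the graph
  connected; this is why vertices that lie in no separating pair are sought. The edge added between
  x and y serves two purposes. It puts x and y into one Kempe component whenever both carry one of
  the two colors, so a swap cannot treat the two ends of the removed side differently. It also
  restricts attention to colorings that distinguish x and y, and two such colorings can be glued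
  after a renaming of colors. A side that has no such coloring is the obstacle that calls for the
  suppression.\<close>

definition neighbors :: "'a set \<Rightarrow> ('a \<Rightarrow> 'a \<Rightarrow> bool) \<Rightarrow> 'a \<Rightarrow> 'a set" where
  "neighbors V E v = {u \<in> V. E v u}"

definition coloring :: "'a set \<Rightarrow> ('a \<Rightarrow> 'a \<Rightarrow> bool) \<Rightarrow> ('a \<Rightarrow> 'c set) \<Rightarrow> ('a \<Rightarrow> 'c) \<Rightarrow> bool" where
  "coloring V E L \<phi> \<longleftrightarrow> (\<forall>v\<in>V. \<phi> v \<in> L v) \<and> (\<forall>u\<in>V. \<forall>v\<in>V. E u v \<longrightarrow> \<phi> u \<noteq> \<phi> v)"

definition swap_on :: "'c \<Rightarrow> 'c \<Rightarrow> 'a set \<Rightarrow> ('a \<Rightarrow> 'c) \<Rightarrow> 'a \<Rightarrow> 'c" where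
  "swap_on a b T \<phi> = (\<lambda>v. if v \<in> T then transpose a b (\<phi> v) else \<phi> v)"

text \<open>Only vertices colored \<open>a\<close> or \<open>b\<close> are constrained, since the
  transposition fixes every other color. Thus a whole side of a separating pair can serve as
  \<open>T\<close>.\<close>

definition kempe_closed ::
    "'a set \<Rightarrow> ('a \<Rightarrow> 'a \<Rightarrow> bool) \<Rightarrow> ('a \<Rightarrow> 'c) \<Rightarrow> 'c \<Rightarrow> 'c \<Rightarrow> 'a set \<Rightarrow> bool" where
  "kempe_closed V E \<phi> a b T \<longleftrightarrow> T \<subseteq> V \<and>
     (\<forall>u\<in>T. \<forall>v\<in>V. E u v \<longrightarrow> \<phi> u \<in> {a, b} \<longrightarrow> \<phi> v \<in> {a, b} \<longrightarrow> v \<in> T)"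

text \<open>
  A step may exchange the two colors on any union of Kempe components, and colorings that agree on
  \<^term>\<open>V\<close> are identified (the case of an empty union).
\<close>

definition kempe_step ::
    "'a set \<Rightarrow> ('a \<Rightarrow> 'a \<Rightarrow> bool) \<Rightarrow> ('a \<Rightarrow> 'c set) \<Rightarrow> ('a \<Rightarrow> 'c) \<Rightarrow> ('a \<Rightarrow> 'c) \<Rightarrow> bool" where
  "kempe_step V E L \<phi> \<psi> \<longleftrightarrow> coloring V E L \<phi> \<and> coloring V E L \<psi> \<and>
     (\<exists>a b T. kempe_closed V E \<phi> a b T \<and> (\<forall>v\<in>V. \<psi> v = swap_on a b T \<phi> v))"

abbreviation kempe_equiv ::
    "'a set \<Rightarrow> ('a \<Rightarrow> 'a \<Rightarrow> bool) \<Rightarrow> ('a \<Rightarrow> 'c set) \<Rightarrow> ('a \<Rightarrow> 'c) \<Rightarrow> ('a \<Rightarrow> 'c) \<Rightarrow> bool" where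
  "kempe_equiv V E L \<equiv> (kempe_step V E L)\<^sup>*\<^sup>*"

definition kempe_connected :: "'a set \<Rightarrow> ('a \<Rightarrow> 'a \<Rightarrow> bool) \<Rightarrow> ('a \<Rightarrow> 'c set) \<Rightarrow> bool" where
  "kempe_connected V E L \<longleftrightarrow> (\<exists>\<phi>. coloring V E L \<phi>) \<and>
     (\<forall>\<phi> \<psi>. coloring V E L \<phi> \<longrightarrow> coloring V E L \<psi> \<longrightarrow> kempe_equiv V E L \<phi> \<psi>)"

abbreviation reach :: "'a set \<Rightarrow> ('a \<Rightarrow> 'a \<Rightarrow> bool) \<Rightarrow> 'a \<Rightarrow> 'a \<Rightarrow> bool" where
  "reach V E \<equiv> (\<lambda>u v. u \<in> V \<and> v \<in> V \<and> E u v)\<^sup>*\<^sup>*"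

section \<open>Swaps on unions of Kempe components\<close>

lemma coloringD:
  assumes "coloring V E L \<phi>"
  shows "v \<in> V \<Longrightarrow> \<phi> v \<in> L v" "u \<in> V \<Longrightarrow> v \<in> V \<Longrightarrow> E u v \<Longrightarrow> \<phi> u \<noteq> \<phi> v"
  using assms by (auto simp: coloring_def)

lemma kempe_closedI:
  assumes "T \<subseteq> V"
    and "\<And>u v. u \<in> T \<Longrightarrow> v \<in> V \<Longrightarrow> E u v \<Longrightarrow> \<phi> u \<in> {a, b} \<Longrightarrow> \<phi> v \<in> {a, b} \<Longrightarrow> v \<in> T"
  shows "kempe_closed V E \<phi> a b T"
  using assms unfolding kempe_closed_def by blast

lemma kempe_closedD:
  assumes "kempe_closed V E \<phi> a b T"
  shows "T \<subseteq> V"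
    and "u \<in> T \<Longrightarrow> v \<in> V \<Longrightarrow> E u v \<Longrightarrow> \<phi> u \<in> {a, b} \<Longrightarrow> \<phi> v \<in> {a, b} \<Longrightarrow> v \<in> T"
  using assms unfolding kempe_closed_def by blast+

lemma transpose_in_pair_iff: "transpose a b c \<in> {a, b} \<longleftrightarrow> c \<in> {a, b}"
  by (auto simp: transpose_def)

lemma swap_on_in_pair_iff: "swap_on a b T \<phi> v \<in> {a, b} \<longleftrightarrow> \<phi> v \<in> {a, b}"
  unfolding swap_on_def using transpose_in_pair_iff[of a b "\<phi> v"] by simp

lemma coloring_swap_on:
  assumes "symp E" "coloring V E L \<phi>" "kempe_closed V E \<phi> a b T"
    and val: "\<And>v. v \<in> T \<Longrightarrow> \<phi> v \<in> {a, b} \<Longrightarrow> a \<in> L v \<and> b \<in> L v"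
  shows "coloring V E L (swap_on a b T \<phi>)"
  unfolding coloring_def
proof (intro conjI ballI impI)
  fix v assume v: "v \<in> V"
  then have "\<phi> v \<in> L v" using assms by (auto simp: coloring_def)
  then show "swap_on a b T \<phi> v \<in> L v" using val[of v] by (auto simp: swap_on_def transpose_def)
next
  fix u v assume uv: "u \<in> V" "v \<in> V" "E u v"
  have ne: "\<phi> u \<noteq> \<phi> v" using assms uv by (auto simp: coloring_def)
  have "E v u" using assms(1) uv by (auto dest: sympD)
  then have "\<phi> u \<in> {a, b} \<Longrightarrow> \<phi> v \<in> {a, b} \<Longrightarrow> u \<in> T \<longleftrightarrow> v \<in> T"
    using assms(3) uv unfolding kempe_closed_def by blast
  then show "swap_on a b T \<phi> u \<noteq> swap_on a b T \<phi> v"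
    using ne by (auto simp: swap_on_def transpose_def)
qed

lemma kempe_step_swap_on:
  assumes "symp E" "coloring V E L \<phi>" "kempe_closed V E \<phi> a b T"
    and "\<And>v. v \<in> T \<Longrightarrow> \<phi> v \<in> {a, b} \<Longrightarrow> a \<in> L v \<and> b \<in> L v"
  shows "kempe_step V E L \<phi> (swap_on a b T \<phi>)"
  using coloring_swap_on[OF assms] assms unfolding kempe_step_def by blast

text \<open>The last fact, that the swap respects the lists, comes from both ends being colorings: a
  vertex of \<open>T\<close> with one of the two colors has the other one after the swap, so its
  list contains both.\<close>

lemma kempe_stepE:
  assumes "kempe_step V E L \<phi> \<psi>"
  obtains a b T where "coloring V E L \<phi>" "coloring V E L \<psi>" "kempe_closed V E \<phi> a b T" "T \<subseteq> V"
    "\<And>v. v \<in> V \<Longrightarrow> \<psi> v = swap_on a b T \<phi> v"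
    "\<And>v. v \<in> T \<Longrightarrow> \<phi> v \<in> {a, b} \<Longrightarrow> a \<in> L v \<and> b \<in> L v"
proof -
  obtain a b T where *: "coloring V E L \<phi>" "coloring V E L \<psi>" "kempe_closed V E \<phi> a b T"
    "\<forall>v\<in>V. \<psi> v = swap_on a b T \<phi> v" using assms unfolding kempe_step_def by blast
  have T: "T \<subseteq> V" using * by (auto simp: kempe_closed_def)
  show thesis
  proof (rule that[of a b T])
    fix v assume v: "v \<in> T" "\<phi> v \<in> {a, b}"
    have "\<phi> v \<in> L v" "\<psi> v \<in> L v" using v T * by (auto simp: coloring_def)
    moreover have "\<psi> v = transpose a b (\<phi> v)" using v T * by (auto simp: swap_on_def)
    ultimately show "a \<in> L v \<and> b \<in> L v" using v by (auto simp: transpose_def split: if_splits)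
  qed (use * T in auto)
qed

lemma kempe_step_coloring: "kempe_step V E L \<phi> \<psi> \<Longrightarrow> coloring V E L \<psi>"
  by (simp add: kempe_step_def)

lemma kempe_step_sym: "kempe_step V E L \<phi> \<psi> \<Longrightarrow> kempe_step V E L \<psi> \<phi>"
proof (erule kempe_stepE)
  fix a b T assume *: "coloring V E L \<phi>" "coloring V E L \<psi>" "kempe_closed V E \<phi> a b T" "T \<subseteq> V"
    "\<And>v. v \<in> V \<Longrightarrow> \<psi> v = swap_on a b T \<phi> v"
  have "\<psi> v \<in> {a, b} \<longleftrightarrow> \<phi> v \<in> {a, b}" if "v \<in> V" for v
    using *(5)[OF that] swap_on_in_pair_iff by metis
  then have "kempe_closed V E \<psi> a b T" using *(3,4) unfolding kempe_closed_def by (meson subsetD)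
  moreover have "\<forall>v\<in>V. \<phi> v = swap_on a b T \<psi> v" using *(5) by (auto simp: swap_on_def)
  ultimately show "kempe_step V E L \<psi> \<phi>" using * unfolding kempe_step_def by blast
qed

lemma kempe_equiv_sym: "kempe_equiv V E L \<phi> \<psi> \<Longrightarrow> kempe_equiv V E L \<psi> \<phi>"
  by (rule sympD[OF symp_rtranclp]) (auto intro: sympI kempe_step_sym)

lemma kempe_equiv_coloring: "kempe_equiv V E L \<phi> \<psi> \<Longrightarrow> coloring V E L \<phi> \<Longrightarrow> coloring V E L \<psi>"
  by (induction rule: rtranclp_induct) (auto simp: kempe_step_def)

lemma kempe_step_agree:
  assumes "coloring V E L \<phi>" "\<And>v. v \<in> V \<Longrightarrow> \<psi> v = \<phi> v"
  shows "kempe_step V E L \<phi> \<psi>"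
proof -
  have "coloring V E L \<psi>" using assms by (auto simp: coloring_def)
  moreover have "kempe_closed V E \<phi> a b {}" for a b by (auto simp: kempe_closed_def)
  moreover have "\<forall>v\<in>V. \<psi> v = swap_on a b {} \<phi> v" for a b using assms by (simp add: swap_on_def)
  ultimately show ?thesis using assms(1) unfolding kempe_step_def by blast
qed

text \<open>No neighbor of \<open>s\<close> carries its old color or its new one, so
  \<open>{s}\<close> is by itself closed for these two colors.\<close>

lemma kempe_step_recolor:
  assumes "symp E" "irreflp E" "coloring V E L \<phi>" "coloring V E L \<psi>"
    and "\<And>v. v \<in> V \<Longrightarrow> v \<noteq> s \<Longrightarrow> \<psi> v = \<phi> v"
  shows "kempe_step V E L \<phi> \<psi>"
proof (cases "s \<in> V")
  case True
  have "kempe_closed V E \<phi> (\<phi> s) (\<psi> s) {s}"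
    unfolding kempe_closed_def
  proof (intro conjI ballI impI)
    fix u v assume u: "u \<in> {s}" "v \<in> V" "E u v" "\<phi> v \<in> {\<phi> s, \<psi> s}"
    have "v \<noteq> s" using u assms(2) by (auto dest: irreflpD)
    then have "\<psi> v = \<phi> v" using assms(5) u by blast
    moreover have "\<phi> v \<noteq> \<phi> s" "\<psi> v \<noteq> \<psi> s"
      using coloringD(2)[OF assms(3), of s v] coloringD(2)[OF assms(4), of s v] u True by auto
    ultimately have "\<phi> v \<noteq> \<phi> s" "\<phi> v \<noteq> \<psi> s" by auto
    then show "v \<in> {s}" using u by auto
  qed (use True in auto)
  moreover have "\<forall>v\<in>V. \<psi> v = swap_on (\<phi> s) (\<psi> s) {s} \<phi> v" using assms(5) by (auto simp: swap_on_def)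
  ultimately show ?thesis using assms(3,4) unfolding kempe_step_def by blast
next
  case False
  then show ?thesis using assms by (metis kempe_step_agree)
qed

section \<open>Lists with slack\<close>

text \<open>
  If \<open>s\<close> cannot be moved to a color outside \<open>{a, b}\<close>, then counting colors shows that at most one
  neighbor of \<open>s\<close> has the other color of this pair, so \<open>s\<close> can be swapped along with it.
\<close>

lemma kempe_step_extend:
  assumes fin: "finite V" and E: "symp E" "irreflp E" and s: "s \<in> V" "finite (L s)"
    and deg: "card (neighbors V E s) < card (L s)"
    and \<phi>: "coloring V E L \<phi>" and st: "kempe_step (V - {s}) E L \<phi> \<theta>"
  shows "\<exists>\<psi>. kempe_equiv V E L \<phi> \<psi> \<and> (\<forall>v\<in>V - {s}. \<psi> v = \<theta> v)"
proof -
  obtain a b T where T: "kempe_closed (V - {s}) E \<phi> a b T" "T \<subseteq> V - {s}"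
    "\<And>v. v \<in> V - {s} \<Longrightarrow> \<theta> v = swap_on a b T \<phi> v"
    "\<And>v. v \<in> T \<Longrightarrow> \<phi> v \<in> {a, b} \<Longrightarrow> a \<in> L v \<and> b \<in> L v"
    using st by (elim kempe_stepE) blast
  let ?N = "neighbors V E s"
  have finN: "finite ?N" using fin by (auto simp: neighbors_def)
  have sN: "s \<notin> ?N" using E by (auto simp: neighbors_def dest: irreflpD)
  have Esym: "E u v \<Longrightarrow> E v u" for u v using E by (auto dest: sympD)
  show ?thesis
  proof (cases "\<exists>e\<in>L s. e \<notin> \<phi> ` ?N \<and> e \<noteq> a \<and> e \<noteq> b")
    case True
    then obtain e where e: "e \<in> L s" "e \<notin> \<phi> ` ?N" "e \<noteq> a" "e \<noteq> b" by blast
    let ?\<chi> = "\<phi>(s := e)"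
    have c1: "coloring V E L ?\<chi>"
      unfolding coloring_def
    proof (intro conjI ballI impI)
      fix u v assume uv: "u \<in> V" "v \<in> V" "E u v"
      have "u \<noteq> v" using uv E by (auto dest: irreflpD)
      then show "?\<chi> u \<noteq> ?\<chi> v"
        using uv Esym[OF uv(3)] e \<phi> by (auto simp: coloring_def neighbors_def)
    qed (use e \<phi> in \<open>auto simp: coloring_def\<close>)
    have 1: "kempe_step V E L \<phi> ?\<chi>" by (rule kempe_step_recolor[OF E \<phi> c1, of s]) auto
    have cl: "kempe_closed V E ?\<chi> a b T"
    proof (rule kempe_closedI)
      fix u v assume uv: "u \<in> T" "v \<in> V" "E u v" "?\<chi> u \<in> {a, b}" "?\<chi> v \<in> {a, b}"
      have "u \<noteq> s" "v \<noteq> s" using uv(4,5) e(3,4) by auto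
      then show "v \<in> T" using kempe_closedD(2)[OF T(1) uv(1), of v] uv by auto
    qed (use T(2) in auto)
    then have 2: "kempe_step V E L ?\<chi> (swap_on a b T ?\<chi>)"
    proof (rule kempe_step_swap_on[OF E(1) c1])
      fix v assume "v \<in> T" "?\<chi> v \<in> {a, b}"
      then show "a \<in> L v \<and> b \<in> L v" using T(2,4) by (auto split: if_splits)
    qed
    have 3: "\<forall>v\<in>V - {s}. swap_on a b T ?\<chi> v = \<theta> v" using T(3) by (auto simp: swap_on_def)
    have "kempe_equiv V E L \<phi> (swap_on a b T ?\<chi>)" using 1 2 by (meson converse_rtranclp_into_rtranclp r_into_rtranclp)
    then show ?thesis using 3 by blast
  next
    case False
    have \<phi>s: "\<phi> s \<in> L s" "\<phi> s \<notin> \<phi> ` ?N" using \<phi> s by (auto simp: coloring_def neighbors_def)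
    then have sab: "\<phi> s \<in> {a, b}" using False by blast
    define d where "d = (if \<phi> s = a then b else a)"
    let ?B = "{u \<in> ?N. \<phi> u = d}"
    have ab: "{a, b} = {\<phi> s, d}" using sab by (auto simp: d_def)
    have sub: "L s - {a, b} \<subseteq> \<phi> ` (?N - ?B)"
    proof
      fix e assume e: "e \<in> L s - {a, b}"
      then have "e \<in> \<phi> ` ?N" "e \<noteq> d" using False by (auto simp: d_def)
      then obtain u where "u \<in> ?N" "\<phi> u = e" by blast
      then show "e \<in> \<phi> ` (?N - ?B)" using \<open>e \<noteq> d\<close> by blast
    qed
    have "card (L s - {a, b}) \<le> card (?N - ?B)"
      using card_mono[OF _ sub] card_image_le[of "?N - ?B" \<phi>] finN by (meson finite_Diff finite_imageI le_trans)
    also have "\<dots> = card ?N - card ?B" using finN by (intro card_Diff_subset) auto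
    finally have le: "card (L s - {a, b}) \<le> card ?N - card ?B" .
    have B_le: "card ?B \<le> card ?N" using finN by (intro card_mono) auto
    have "card (L s) = card (L s \<inter> {a, b}) + card (L s - {a, b})"
      using s(2) by (metis card_Int_Diff)
    \<comment> \<open>Each list color outside the pair is spent on a neighbor outside
      \<open>?B\<close>. What is left bounds \<open>?B\<close> by one vertex, and if there is one,
      both colors lie in \<open>L s\<close>, so that swapping \<open>s\<close> is valid.\<close>
    then have more: "card (L s \<inter> {a, b}) > card ?B" using deg le B_le by linarith
    have le_pair: "card (L s \<inter> {a, b}) \<le> card {a, b}" by (intro card_mono) auto
    have "card {a, b} \<le> 2" by (simp add: card_insert_if)
    then have le2: "card (L s \<inter> {a, b}) \<le> 2" using le_pair by linarith
    define T' where "T' = (if \<exists>u\<in>T. u \<in> ?B then insert s T else T)"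
    have single: "u = w" if "u \<in> ?B" "w \<in> ?B" for u w
    proof -
      have "card ?B \<le> 1" using more le2 by linarith
      moreover have "finite ?B" using finN by simp
      ultimately show ?thesis using that by (meson card_le_Suc0_iff_eq[unfolded One_nat_def[symmetric]])
    qed
    have cl: "kempe_closed V E \<phi> a b T'"
      unfolding kempe_closed_def
    proof (intro conjI ballI impI)
      show "T' \<subseteq> V" using T(2) s by (auto simp: T'_def)
    next
      fix u v assume uv: "u \<in> T'" "v \<in> V" "E u v" "\<phi> u \<in> {a, b}" "\<phi> v \<in> {a, b}"
      have ne: "\<phi> u \<noteq> \<phi> v" "u \<in> V" "u \<noteq> v"
        using uv \<phi> T(2) s E by (auto simp: coloring_def T'_def split: if_splits dest: irreflpD)
      consider "u = s" | "v = s" "u \<in> T" | "u \<in> T" "v \<noteq> s" using uv by (auto simp: T'_def split: if_splits)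
      then show "v \<in> T'"
      proof cases
        case 1
        then have vB: "v \<in> ?B" using uv ne ab by (auto simp: neighbors_def)
        have "s \<notin> T" using T(2) by auto
        then obtain w where "w \<in> T" "w \<in> ?B" using 1 uv(1) by (auto simp: T'_def split: if_splits)
        then show ?thesis using single[OF vB] by (auto simp: T'_def)
      next
        case 2
        then have "u \<in> ?B" using uv ne ab Esym by (auto simp: neighbors_def)
        then show ?thesis using 2 by (auto simp: T'_def)
      next
        case 3
        then have "v \<in> T" using kempe_closedD(2)[OF T(1), of u v] uv by auto
        then show ?thesis by (auto simp: T'_def)
      qed
    qed
    have "kempe_step V E L \<phi> (swap_on a b T' \<phi>)"
    proof (rule kempe_step_swap_on[OF E(1) \<phi> cl])
      fix v assume v: "v \<in> T'" "\<phi> v \<in> {a, b}"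
      show "a \<in> L v \<and> b \<in> L v"
      proof (cases "v \<in> T")
        case True then show ?thesis using T(4) v by blast
      next
        case False
        then have "v = s" and ex: "\<exists>u. u \<in> ?B" using v by (auto simp: T'_def split: if_splits)
        have "?B \<noteq> {}" "finite ?B" using ex finN by auto
        then have "0 < card ?B" by (simp only: card_gt_0_iff) blast
        then have 2: "2 \<le> card (L s \<inter> {a, b})" using more by linarith
        have "L s \<inter> {a, b} = {a, b}"
        proof (rule card_subset_eq)
          show "card (L s \<inter> {a, b}) = card {a, b}"
            using 2 le2 le_pair by (cases "a = b") auto
        qed auto
        then show ?thesis using \<open>v = s\<close> by blast
      qed
    qed
    moreover have "\<forall>v\<in>V - {s}. swap_on a b T' \<phi> v = \<theta> v" using T(3) by (auto simp: swap_on_def T'_def)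
    ultimately show ?thesis by blast
  qed
qed

text \<open>A lifted coloring agrees with \<theta> only on \<open>V'\<close>, so each swap is reread
  as one that starts at the lifted coloring. \<open>P\<close> carries what the next lift needs, for
  instance that precolored vertices keep their colors.\<close>

lemma kempe_equiv_lift:
  assumes step: "\<And>\<phi> \<theta>. P \<phi> \<Longrightarrow> kempe_step V' E' L' \<phi> \<theta> \<Longrightarrow>
      \<exists>\<psi>. kempe_equiv V E L \<phi> \<psi> \<and> P \<psi> \<and> (\<forall>v\<in>V'. \<psi> v = \<theta> v)"
    and "P \<phi>" and eq: "kempe_equiv V' E' L' \<phi> \<theta>"
  shows "\<exists>\<psi>. kempe_equiv V E L \<phi> \<psi> \<and> P \<psi> \<and> (\<forall>v\<in>V'. \<psi> v = \<theta> v)"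
  using eq
proof (induction rule: rtranclp_induct)
  case base
  then show ?case using \<open>P \<phi>\<close> by blast
next
  case (step \<theta> \<theta>')
  then obtain \<psi> where \<psi>: "kempe_equiv V E L \<phi> \<psi>" "P \<psi>" "\<forall>v\<in>V'. \<psi> v = \<theta> v" by blast
  obtain a b T where T: "coloring V' E' L' \<theta>" "coloring V' E' L' \<theta>'" "kempe_closed V' E' \<theta> a b T"
     "T \<subseteq> V'" "\<And>v. v \<in> V' \<Longrightarrow> \<theta>' v = swap_on a b T \<theta> v"
    using step(2) by (elim kempe_stepE) blast
  have "coloring V' E' L' \<psi>" using T(1) \<psi>(3) by (auto simp: coloring_def)
  moreover have "kempe_closed V' E' \<psi> a b T"
  proof (rule kempe_closedI[OF T(4)])
    fix u v assume uv: "u \<in> T" "v \<in> V'" "E' u v" "\<psi> u \<in> {a, b}" "\<psi> v \<in> {a, b}"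
    then show "v \<in> T" using kempe_closedD(2)[OF T(3) uv(1-3)] \<psi>(3) T(4) by auto
  qed
  moreover have "\<forall>v\<in>V'. \<theta>' v = swap_on a b T \<psi> v" using T(5) \<psi>(3) by (auto simp: swap_on_def)
  ultimately have "kempe_step V' E' L' \<psi> \<theta>'" using T(2) unfolding kempe_step_def by blast
  then obtain \<psi>' where "kempe_equiv V E L \<psi> \<psi>'" "P \<psi>'" "\<forall>v\<in>V'. \<psi>' v = \<theta>' v"
    using assms(1) \<psi>(2) by blast
  then show ?case using \<psi>(1) by (meson rtranclp_trans)
qed

text \<open>Lifting the swaps of \<open>V - {s}\<close> yields a coloring that differs from the
  target at most at \<open>s\<close>, and recoloring one vertex is a step.\<close>

lemma kempe_connected_extend:
  assumes fin: "finite V" and E: "symp E" "irreflp E" and s: "s \<in> V" "finite (L s)"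
    and deg: "card (neighbors V E s) < card (L s)"
    and con: "kempe_connected (V - {s}) E L"
  shows "kempe_connected V E L"
  unfolding kempe_connected_def
proof (intro conjI allI impI)
  obtain \<theta> where \<theta>: "coloring (V - {s}) E L \<theta>" using con by (auto simp: kempe_connected_def)
  have finN: "finite (neighbors V E s)" using fin by (auto simp: neighbors_def)
  have "card (\<theta> ` neighbors V E s) < card (L s)" using deg card_image_le[OF finN] le_less_trans by blast
  then obtain e where e: "e \<in> L s" "e \<notin> \<theta> ` neighbors V E s"
    using finN by (meson card_mono finite_imageI linorder_not_le subsetI)
  have "coloring V E L (\<theta>(s := e))"
    unfolding coloring_def
  proof (intro conjI ballI impI)
    fix u v assume uv: "u \<in> V" "v \<in> V" "E u v"
    have "u \<noteq> v" "E v u" using uv E by (auto dest: irreflpD sympD)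
    then show "(\<theta>(s := e)) u \<noteq> (\<theta>(s := e)) v"
      using uv e \<theta> by (auto simp: coloring_def neighbors_def)
  qed (use e \<theta> in \<open>auto simp: coloring_def\<close>)
  then show "\<exists>\<phi>. coloring V E L \<phi>" by blast
next
  fix \<phi> \<psi> assume \<phi>: "coloring V E L \<phi>" and \<psi>: "coloring V E L \<psi>"
  have "kempe_equiv (V - {s}) E L \<phi> \<psi>"
    using con \<phi> \<psi> by (auto simp: kempe_connected_def coloring_def)
  moreover have "\<exists>\<chi>'. kempe_equiv V E L \<chi> \<chi>' \<and> coloring V E L \<chi>' \<and> (\<forall>v\<in>V - {s}. \<chi>' v = \<theta> v)"
    if "coloring V E L \<chi>" "kempe_step (V - {s}) E L \<chi> \<theta>" for \<chi> \<theta>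
    using kempe_step_extend[OF fin E s deg that] kempe_equiv_coloring that(1) by blast
  ultimately obtain \<chi> where \<chi>: "kempe_equiv V E L \<phi> \<chi>" "coloring V E L \<chi>" "\<forall>v\<in>V - {s}. \<chi> v = \<psi> v"
    using kempe_equiv_lift[where P = "coloring V E L", OF _ \<phi>] by blast
  have "kempe_step V E L \<chi> \<psi>" by (rule kempe_step_recolor[OF E \<chi>(2) \<psi>, of s]) (use \<chi>(3) in auto)
  then show "kempe_equiv V E L \<phi> \<psi>" using \<chi>(1) by (meson rtranclp.rtrancl_into_rtrancl)
qed

text \<open>Deleting a vertex \<open>s\<close> with slack gives slack to all its neighbors. A walk
  towards a slack vertex therefore either survives the deletion or meets a neighbor of
  \<open>s\<close> first, and induction applies to the rest.\<close>

lemma kempe_connected_if_slack: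
  assumes "finite V" "symp E" "irreflp E"
    and "\<And>v. v \<in> V \<Longrightarrow> finite (L v) \<and> card (neighbors V E v) \<le> card (L v)"
    and "\<And>v. v \<in> V \<Longrightarrow> \<exists>t\<in>V. reach V E v t \<and> card (neighbors V E t) < card (L t)"
  shows "kempe_connected V E L"
  using assms(1,4,5)
proof (induction "card V" arbitrary: V rule: less_induct)
  case (less V)
  note E = assms(2,3)
  show ?case
  proof (cases "V = {}")
    case True
    then show ?thesis
      using kempe_step_agree[of V E L] by (auto simp: kempe_connected_def coloring_def)
  next
    case False
    then obtain s where s: "s \<in> V" "card (neighbors V E s) < card (L s)" using less.prems(3) by blast
    let ?U = "V - {s}"
    have mono: "card (neighbors ?U E v) \<le> card (neighbors V E v)" for v
      by (intro card_mono) (use less.prems(1) in \<open>auto simp: neighbors_def\<close>)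
    have strict: "card (neighbors ?U E v) < card (neighbors V E v)" if "E v s" for v
      by (intro psubset_card_mono) (use less.prems(1) that s in \<open>auto simp: neighbors_def\<close>)
    have slack: "\<exists>t\<in>?U. reach ?U E v t \<and> card (neighbors ?U E t) < card (L t)" if v: "v \<in> ?U" for v
    proof -
      obtain t where t: "t \<in> V" "reach V E v t" "card (neighbors V E t) < card (L t)"
        using less.prems(3)[of v] v by blast
      from t(2) v show ?thesis
      proof (induction rule: converse_rtranclp_induct)
        case base
        then show ?case using t(3) mono[of t] by (meson le_less_trans rtranclp.rtrancl_refl)
      next
        case (step v w)
        show ?case
        proof (cases "w = s")
          case True
          then have "card (neighbors ?U E v) < card (L v)"
            using strict[of v] step less.prems(2)[of v] by auto
          then show ?thesis using step.prems by blast
        next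
          case False
          then obtain t' where "t' \<in> ?U" "reach ?U E w t'" "card (neighbors ?U E t') < card (L t')"
            using step by auto
          moreover have "reach ?U E v t'"
            by (rule converse_rtranclp_into_rtranclp[OF _ \<open>reach ?U E w t'\<close>])
              (use False step in auto)
          ultimately show ?thesis by blast
        qed
      qed
    qed
    have "kempe_connected ?U E L"
    proof (rule less.hyps)
      show "card ?U < card V" using s less.prems(1) by (meson card_Diff1_less)
      show "finite ?U" using less.prems(1) by auto
      show "finite (L v) \<and> card (neighbors ?U E v) \<le> card (L v)" if "v \<in> ?U" for v
        using that less.prems(2)[of v] mono[of v] by auto
    qed (use slack in auto)
    then show ?thesis using kempe_connected_extend[of V E s L] less.prems E s by blast
  qed
qed

text \<open>Deleting \<open>S\<close> and removing its colors from the adjacent lists costs a vertex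
  at most one color per lost neighbor. A lost neighbor whose color is not in the list costs nothing,
  which is the slack.\<close>

lemma kempe_equiv_if_precolored:
  assumes fin: "finite V" and E: "symp E" "irreflp E"
    and deg: "\<And>v. v \<in> V \<Longrightarrow> finite (L v) \<and> card (neighbors V E v) \<le> card (L v)"
    and S: "S \<subseteq> V" and f: "coloring S E L f"
    and slack: "\<And>v. v \<in> V - S \<Longrightarrow> \<exists>t\<in>V - S. reach (V - S) E v t \<and> (\<exists>s\<in>S. E t s \<and> f s \<notin> L t)"
  shows "\<exists>\<phi>. coloring V E L \<phi> \<and> (\<forall>s\<in>S. \<phi> s = f s)"
    and "coloring V E L \<phi> \<Longrightarrow> coloring V E L \<psi> \<Longrightarrow> \<forall>s\<in>S. \<phi> s = f s \<Longrightarrow> \<forall>s\<in>S. \<psi> s = f s \<Longrightarrow>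
      kempe_equiv V E L \<phi> \<psi>"
proof -
  define L' where "L' = (\<lambda>v. L v - f ` neighbors S E v)"
  have Esym: "E u v \<Longrightarrow> E v u" for u v using E by (auto dest: sympD)
  have finS: "finite S" using S fin finite_subset by blast
  have finN: "finite (neighbors S E v)" for v using finS by (auto simp: neighbors_def)
  have split: "card (neighbors V E v) = card (neighbors (V - S) E v) + card (neighbors S E v)" for v
  proof -
    have "neighbors V E v = neighbors (V - S) E v \<union> neighbors S E v" using S by (auto simp: neighbors_def)
    moreover have "neighbors (V - S) E v \<inter> neighbors S E v = {}" by (auto simp: neighbors_def)
    moreover have "finite (neighbors (V - S) E v)" using fin by (auto simp: neighbors_def)
    ultimately show ?thesis using finN[of v] by (simp add: card_Un_disjoint)
  qed
  have con: "kempe_connected (V - S) E L'"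
  proof (rule kempe_connected_if_slack)
    fix v assume v: "v \<in> V - S"
    have "card (L v) - card (neighbors S E v) \<le> card (L v) - card (f ` neighbors S E v)"
      using card_image_le[OF finN, of f v] by linarith
    also have "\<dots> \<le> card (L' v)" unfolding L'_def by (intro diff_card_le_card_Diff) (use finN in auto)
    finally show "finite (L' v) \<and> card (neighbors (V - S) E v) \<le> card (L' v)"
      using deg[of v] split[of v] v by (auto simp: L'_def)
  next
    fix v assume v: "v \<in> V - S"
    then obtain t s where t: "t \<in> V - S" "reach (V - S) E v t" "s \<in> S" "E t s" "f s \<notin> L t"
      using slack by blast
    let ?N = "neighbors S E t"
    have sN: "s \<in> ?N" using t by (auto simp: neighbors_def)
    have L't: "L' t = L t - f ` (?N - {s})" using t by (auto simp: L'_def)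
    have "card (f ` (?N - {s})) \<le> card ?N - 1"
      using card_image_le[of "?N - {s}" f] finN[of t] sN by (simp add: card_Diff_singleton)
    then have "card (L t) - (card ?N - 1) \<le> card (L t) - card (f ` (?N - {s}))" by linarith
    also have "\<dots> \<le> card (L' t)" unfolding L't by (intro diff_card_le_card_Diff) (use finN in auto)
    finally have "card (L t) - (card ?N - 1) \<le> card (L' t)" .
    moreover have "card ?N > 0" using sN finN[of t] card_gt_0_iff by blast
    ultimately have "card (neighbors (V - S) E t) < card (L' t)"
      using deg[of t] split[of t] t(1) by auto
    then show "\<exists>t\<in>V - S. reach (V - S) E v t \<and> card (neighbors (V - S) E t) < card (L' t)"
      using t by blast
  qed (use fin E in auto)
  define ext where "ext = (\<lambda>\<theta> v. if v \<in> S then f v else \<theta> v)"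
  have ext: "coloring V E L (ext \<theta>)" if \<theta>: "coloring (V - S) E L' \<theta>" for \<theta>
    unfolding coloring_def
  proof (intro conjI ballI impI)
    fix v assume "v \<in> V"
    then show "ext \<theta> v \<in> L v" using \<theta> f by (auto simp: ext_def coloring_def L'_def)
  next
    fix u v assume uv: "u \<in> V" "v \<in> V" "E u v"
    have *: "f s \<noteq> \<theta> w" if "s \<in> S" "w \<in> V - S" "E w s" for s w
    proof -
      have "\<theta> w \<in> L' w" using \<theta> that by (auto simp: coloring_def)
      moreover have "f s \<in> f ` neighbors S E w" using that by (auto simp: neighbors_def)
      ultimately show ?thesis by (auto simp: L'_def)
    qed
    show "ext \<theta> u \<noteq> ext \<theta> v"
      using uv *[of u v] *[of v u] Esym[OF uv(3)] coloringD(2)[OF \<theta>, of u v] coloringD(2)[OF f, of u v]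
      by (auto simp: ext_def)
  qed
  show "\<exists>\<phi>. coloring V E L \<phi> \<and> (\<forall>s\<in>S. \<phi> s = f s)"
  proof -
    obtain \<theta> where "coloring (V - S) E L' \<theta>" using con by (auto simp: kempe_connected_def)
    then show ?thesis using ext[of \<theta>] by (auto simp: ext_def intro: exI[of _ "ext \<theta>"])
  qed
  show "kempe_equiv V E L \<phi> \<psi>"
    if \<phi>: "coloring V E L \<phi>" and \<psi>: "coloring V E L \<psi>" and eqf: "\<forall>s\<in>S. \<phi> s = f s" "\<forall>s\<in>S. \<psi> s = f s"
  proof -
    have restr: "coloring (V - S) E L' \<chi>" if \<chi>: "coloring V E L \<chi>" "\<forall>s\<in>S. \<chi> s = f s" for \<chi>
      unfolding coloring_def
    proof (intro conjI ballI impI)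
      fix v assume v: "v \<in> V - S"
      have "\<chi> v \<noteq> f s" if "s \<in> neighbors S E v" for s
        using coloringD(2)[OF \<chi>(1), of v s] \<chi>(2) that v S by (auto simp: neighbors_def)
      then show "\<chi> v \<in> L' v" using coloringD(1)[OF \<chi>(1), of v] v by (auto simp: L'_def)
    qed (use \<chi> in \<open>auto simp: coloring_def\<close>)
    have "kempe_equiv (V - S) E L' \<phi> \<psi>" using con restr \<phi> \<psi> eqf by (auto simp: kempe_connected_def)
    moreover have "\<exists>\<chi>'. kempe_equiv V E L \<chi> \<chi>' \<and> (coloring V E L \<chi>' \<and> (\<forall>s\<in>S. \<chi>' s = f s)) \<and>
        (\<forall>v\<in>V - S. \<chi>' v = \<theta> v)"
      if P: "coloring V E L \<chi> \<and> (\<forall>s\<in>S. \<chi> s = f s)" and st: "kempe_step (V - S) E L' \<chi> \<theta>" for \<chi> \<theta>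
      using st
    proof (elim kempe_stepE)
      fix a b T assume T: "coloring (V - S) E L' \<theta>" "kempe_closed (V - S) E \<chi> a b T" "T \<subseteq> V - S"
        "\<And>v. v \<in> V - S \<Longrightarrow> \<theta> v = swap_on a b T \<chi> v"
        "\<And>v. v \<in> T \<Longrightarrow> \<chi> v \<in> {a, b} \<Longrightarrow> a \<in> L' v \<and> b \<in> L' v"
      have "kempe_closed V E \<chi> a b T"
      proof (rule kempe_closedI)
        fix u v assume uv: "u \<in> T" "v \<in> V" "E u v" "\<chi> u \<in> {a, b}" "\<chi> v \<in> {a, b}"
        show "v \<in> T"
        proof (cases "v \<in> S")
          case True
          \<comment> \<open>The reduced list of \<open>u\<close> contains both swapped colors but no
            color of a neighbor in \<open>S\<close>, so the swap never touches
            \<open>S\<close>.\<close>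
          then have "\<chi> v \<in> f ` neighbors S E u" using P uv by (auto simp: neighbors_def)
          then show ?thesis using T(5)[OF uv(1,4)] uv(5) by (auto simp: L'_def)
        next
          case False
          then show ?thesis using kempe_closedD(2)[OF T(2), of u v] uv by auto
        qed
      qed (use T in auto)
      moreover have "a \<in> L v \<and> b \<in> L v" if "v \<in> T" "\<chi> v \<in> {a, b}" for v
        using T(5)[OF that] by (auto simp: L'_def)
      ultimately have "kempe_step V E L \<chi> (swap_on a b T \<chi>)"
        using P E(1) by (intro kempe_step_swap_on) auto
      moreover have "swap_on a b T \<chi> s = f s" if "s \<in> S" for s
        using that P T(3) by (auto simp: swap_on_def)
      ultimately show ?thesis using T(4) kempe_step_coloring by (metis r_into_rtranclp)
    qed
    ultimately obtain \<chi> where \<chi>: "kempe_equiv V E L \<phi> \<chi>" "coloring V E L \<chi>" "\<forall>s\<in>S. \<chi> s = f s"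
        "\<forall>v\<in>V - S. \<chi> v = \<psi> v"
      using kempe_equiv_lift[where P = "\<lambda>\<chi>. coloring V E L \<chi> \<and> (\<forall>s\<in>S. \<chi> s = f s)" and V' = "V - S"
          and E' = E and L' = L' and V = V and E = E and L = L and \<phi> = \<phi> and \<theta> = \<psi>] \<phi> eqf(1) by blast
    have "kempe_step V E L \<chi> \<psi>" using \<chi>(3,4) eqf(2) by (intro kempe_step_agree[OF \<chi>(2)]) (metis DiffI)
    then show ?thesis using \<chi>(1) by (meson rtranclp.rtrancl_into_rtrancl)
  qed
qed

section \<open>Walks inside a vertex set\<close>

lemma reach_stays:
  assumes "reach U E u v" "u \<in> A" "\<And>u v. u \<in> A \<Longrightarrow> u \<in> U \<Longrightarrow> v \<in> U \<Longrightarrow> E u v \<Longrightarrow> v \<in> A"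
  shows "v \<in> A"
  using assms(1,2) by (induction rule: rtranclp_induct) (auto intro: assms(3))

lemma reach_mono:
  assumes "reach U E u v" "U \<subseteq> U'" "\<And>u v. E u v \<Longrightarrow> E' u v"
  shows "reach U' E' u v"
  using assms(1) by (rule rtranclp_mono[THEN predicate2D, rotated]) (use assms(2,3) in auto)

lemma reach_sym: "symp E \<Longrightarrow> reach U E u v \<Longrightarrow> reach U E v u"
  by (rule sympD[OF symp_rtranclp]) (auto intro!: sympI dest: sympD)

section \<open>Separating pairs\<close>

locale biconnected_regular =
  fixes V :: "'a set" and E :: "'a \<Rightarrow> 'a \<Rightarrow> bool" and k :: nat
  assumes finite_V: "finite V" and sym_E: "symp E" and irrefl_E: "irreflp E"
    and k_ge_3: "k \<ge> 3"
    and degree: "v \<in> V \<Longrightarrow> card (neighbors V E v) = k"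
    and no_cutvertex: "s \<in> V \<Longrightarrow> u \<in> V - {s} \<Longrightarrow> v \<in> V - {s} \<Longrightarrow> reach (V - {s}) E u v"
begin

lemma E_sym: "E u v \<Longrightarrow> E v u"
  using sym_E by (auto dest: sympD)

lemma E_irrefl: "\<not> E u u"
  using irrefl_E by (auto dest: irreflpD)

lemma no_cutvertex_set:
  assumes "A \<noteq> {}" "A \<subseteq> V - {p}" "p \<in> V" "V - A - {p} \<noteq> {}"
    and "\<And>u v. u \<in> A \<Longrightarrow> v \<in> V - A - {p} \<Longrightarrow> \<not> E u v"
  shows False
proof -
  obtain u v where uv: "u \<in> A" "v \<in> V - A - {p}" using assms(1,4) by blast
  have "reach (V - {p}) E u v" using uv assms(2,3) by (intro no_cutvertex) auto
  then have "v \<in> A"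
    by (rule reach_stays) (use uv assms(5) in auto)
  then show False using uv by auto
qed

lemma degree_gt_2: "v \<in> V \<Longrightarrow> neighbors V E v \<subseteq> {x, y} \<Longrightarrow> False"
proof -
  assume "v \<in> V" "neighbors V E v \<subseteq> {x, y}"
  then have "k \<le> card {x, y}" using degree[of v] card_mono[of "{x, y}"] by auto
  also have "\<dots> \<le> 2" by (simp add: card_insert_if)
  finally show False using k_ge_3 by simp
qed

definition fragment :: "'a set \<Rightarrow> 'a \<Rightarrow> 'a \<Rightarrow> bool" where
  "fragment W x y \<longleftrightarrow> W \<noteq> {} \<and> W \<subseteq> V \<and> x \<in> V - W \<and> y \<in> V - W \<and> x \<noteq> y \<and> V - W - {x, y} \<noteq> {} \<and>
     (\<forall>u\<in>W. \<forall>v\<in>V - W - {x, y}. \<not> E u v)"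

definition minimal_fragment :: "'a set \<Rightarrow> 'a \<Rightarrow> 'a \<Rightarrow> bool" where
  "minimal_fragment W x y \<longleftrightarrow> fragment W x y \<and> (\<forall>W' x' y'. fragment W' x' y' \<longrightarrow> \<not> W' \<subset> W)"

lemma fragmentI:
  assumes "W \<noteq> {}" "W \<subseteq> V" "x \<in> V - W" "y \<in> V - W" "x \<noteq> y" "V - W - {x, y} \<noteq> {}"
    and "\<And>u v. u \<in> W \<Longrightarrow> v \<in> V \<Longrightarrow> v \<notin> W \<Longrightarrow> v \<noteq> x \<Longrightarrow> v \<noteq> y \<Longrightarrow> \<not> E u v"
  shows "fragment W x y"
  using assms unfolding fragment_def by blast

lemma fragmentD:
  assumes "fragment W x y"
  shows "W \<noteq> {}" "W \<subseteq> V" "x \<in> V" "x \<notin> W" "y \<in> V" "y \<notin> W" "x \<noteq> y" "V - W - {x, y} \<noteq> {}"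
    and "u \<in> W \<Longrightarrow> v \<in> V \<Longrightarrow> v \<notin> W \<Longrightarrow> v \<noteq> x \<Longrightarrow> v \<noteq> y \<Longrightarrow> \<not> E u v"
    and "u \<in> W \<Longrightarrow> v \<in> V \<Longrightarrow> v \<notin> W \<Longrightarrow> v \<noteq> x \<Longrightarrow> v \<noteq> y \<Longrightarrow> \<not> E v u"
  using assms E_sym[of v u] unfolding fragment_def by blast+

lemma fragment_commute: "fragment W x y \<Longrightarrow> fragment W y x"
  unfolding fragment_def by (simp add: insert_commute) blast

lemma fragment_compl: "fragment W x y \<Longrightarrow> fragment (V - W - {x, y}) x y"
proof (rule fragmentI)
  assume W: "fragment W x y"
  have "V - (V - W - {x, y}) - {x, y} = W" using fragmentD[OF W] by blast
  then show "V - (V - W - {x, y}) - {x, y} \<noteq> {}" using fragmentD(1)[OF W] by simp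
  show "\<not> E u v" if "u \<in> V - W - {x, y}" "v \<in> V" "v \<notin> V - W - {x, y}" "v \<noteq> x" "v \<noteq> y" for u v
    using fragmentD(10)[OF W, of v u] that by blast
qed (auto dest: fragmentD)

text \<open>Otherwise \<open>y\<close> alone would separate \<open>W\<close> from
  \<open>x\<close>.\<close>

lemma fragment_boundary_neighbor:
  assumes "fragment W x y"
  shows "\<exists>u\<in>W. E x u"
proof (rule ccontr)
  assume no: "\<not> ?thesis"
  note W = fragmentD[OF assms]
  show False
  proof (rule no_cutvertex_set[of W y])
    fix u v assume "u \<in> W" "v \<in> V - W - {y}"
    then show "\<not> E u v" using W(9)[of u v] no E_sym[of u v] by (cases "v = x") auto
  qed (use W in auto)
qed

text \<open>With \<open>y\<close> deleted, a walk from outside can enter \<open>W\<close> only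
  through \<open>x\<close>, so it has reached \<open>x\<close> before.\<close>

lemma fragment_reach:
  assumes "fragment W x y" "z \<in> V - W - {y}"
  shows "reach (V - W - {y}) E z x"
proof -
  note W = fragmentD[OF assms(1)]
  have "reach (V - {y}) E z x" using W assms(2) by (intro no_cutvertex) auto
  then show ?thesis using assms(2)
  proof (induction rule: converse_rtranclp_induct)
    case (step z w)
    show ?case
    proof (cases "w \<in> W")
      case True
      then have "z = x" using W(10)[of w z] step by auto
      then show ?thesis by simp
    next
      case False
      then show ?thesis
        by (intro converse_rtranclp_into_rtranclp[OF _ step.IH]) (use step in auto)
    qed
  qed simp
qed

section \<open>Minimal fragments avoid all separating pairs\<close>

lemma minimal_fragmentD:
  assumes "minimal_fragment W x y"
  shows "fragment W x y" "fragment W' x' y' \<Longrightarrow> W' \<subset> W \<Longrightarrow> False"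
  using assms by (auto simp: minimal_fragment_def)

lemma minimal_fragment_commute: "minimal_fragment W x y \<Longrightarrow> minimal_fragment W y x"
  using fragment_commute by (auto simp: minimal_fragment_def)

lemma minimal_fragment_exists:
  assumes "fragment W x y"
  shows "\<exists>W' x' y'. minimal_fragment W' x' y' \<and> W' \<subseteq> W"
  using assms
proof (induction "card W" arbitrary: W x y rule: less_induct)
  case (less W)
  show ?case
  proof (cases "minimal_fragment W x y")
    case False
    then obtain W' x' y' where W': "fragment W' x' y'" "W' \<subset> W"
      using less.prems by (auto simp: minimal_fragment_def)
    moreover have "card W' < card W"
      using W' fragmentD(2)[OF less.prems] finite_V by (meson finite_subset psubset_card_mono)
    ultimately show ?thesis using less.hyps[of W' x' y'] by blast
  qed blast
qed

text \<open>If \<open>A\<close> meets \<open>W\<close>, then \<open>A \<inter> W\<close> is a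
  smaller fragment for the pair \<open>v\<close>, \<open>p\<close>. Otherwise \<open>A\<close> lies
  beyond \<open>x\<close> and \<open>y\<close>, has no edge to \<open>v\<close>, and
  \<open>p\<close> alone is a cutvertex.\<close>

lemma minimal_fragment_no_cut_one_sided:
  assumes "minimal_fragment W x y" "v \<in> W" "fragment A v p" "x \<notin> A" "y \<notin> A"
  shows False
proof -
  note W = fragmentD[OF minimal_fragmentD(1)[OF assms(1)]]
  note A = fragmentD[OF assms(3)]
  have empty: "A \<inter> W = {}"
  proof (rule ccontr)
    assume ne: "A \<inter> W \<noteq> {}"
    have "fragment (A \<inter> W) v p"
    proof (rule fragmentI[OF ne])
      fix u z assume "u \<in> A \<inter> W" "z \<in> V" "z \<notin> A \<inter> W" "z \<noteq> v" "z \<noteq> p"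
      then show "\<not> E u z" using W(9)[of u z] A(9)[of u z] assms(4,5) by blast
    qed (use A in auto)
    then show False using minimal_fragmentD(2)[OF assms(1)] assms(2) A(4) by blast
  qed
  show False
  proof (rule no_cutvertex_set[of A p])
    fix u z assume uz: "u \<in> A" "z \<in> V - A - {p}"
    then have "u \<in> V" "u \<notin> W" "u \<noteq> x" "u \<noteq> y" using empty A(2) assms(4,5) by auto
    then show "\<not> E u z" using W(10)[of v u] A(9)[of u z] uz assms(2) by (cases "z = v") auto
  qed (use A W(2) assms(2) in auto)
qed

text \<open>Uncrossing of the two cuts. If \<open>p\<close> is in \<open>W\<close>, the part of
  \<open>?Z\<close> in \<open>A\<close> hangs on \<open>x\<close> alone and the rest of
  \<open>?Z\<close> on \<open>y\<close> alone, so both are empty. If \<open>p\<close> is outside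
  \<open>W\<close>, the parts of \<open>W\<close> in \<open>A\<close> and in \<open>?B\<close> are
  cut off by \<open>v\<close> together with \<open>x\<close> or \<open>y\<close>; minimality leaves
  only \<open>v\<close>, whose degree is then too small.\<close>

lemma minimal_fragment_no_cut_two_sided:
  assumes "minimal_fragment W x y" "v \<in> W" "fragment A v p" "x \<in> A" "y \<notin> A" "y \<noteq> p"
  shows False
proof -
  note W = fragmentD[OF minimal_fragmentD(1)[OF assms(1)]]
  note A = fragmentD[OF assms(3)]
  have yv: "y \<noteq> v" and xp: "x \<noteq> v" "x \<noteq> p" using W A assms by auto
  let ?Z = "V - W - {x, y}"
  let ?B = "V - A - {v, p}"
  show False
  proof (cases "p \<in> W")
    case True
    have "?Z \<inter> A = {}"
    proof (rule ccontr)
      assume ne: "?Z \<inter> A \<noteq> {}"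
      show False
      proof (rule no_cutvertex_set[OF ne, of x])
        fix u z assume uz: "u \<in> ?Z \<inter> A" "z \<in> V - ?Z \<inter> A - {x}"
        show "\<not> E u z"
        proof (cases "z \<in> W")
          case True then show ?thesis using W(10)[of z u] uz by auto
        next
          case False
          then have "z \<notin> A" "z \<noteq> v" "z \<noteq> p" using uz assms(2,5) \<open>p \<in> W\<close> by auto
          then show ?thesis using A(9)[of u z] uz by auto
        qed
      qed (use W assms in auto)
    qed
    moreover have "?Z - A = {}"
    proof (rule ccontr)
      assume ne: "?Z - A \<noteq> {}"
      show False
      proof (rule no_cutvertex_set[OF ne, of y])
        fix u z assume uz: "u \<in> ?Z - A" "z \<in> V - (?Z - A) - {y}"
        show "\<not> E u z"
        proof (cases "z \<in> W")
          case True then show ?thesis using W(10)[of z u] uz by auto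
        next
          case False
          then have "z \<in> A" using uz assms(4) by auto
          moreover have "u \<noteq> v" "u \<noteq> p" using uz assms(2) \<open>p \<in> W\<close> by auto
          ultimately show ?thesis using A(10)[of z u] uz by auto
        qed
      qed (use W assms in auto)
    qed
    ultimately show False using W(8) by blast
  next
    case False
    then have pZ: "p \<in> ?Z" using A(5) assms(6) xp by auto
    have "A \<inter> W = {}"
    proof (rule ccontr)
      assume ne: "A \<inter> W \<noteq> {}"
      have "fragment (A \<inter> W) v x"
      proof (rule fragmentI[OF ne])
        fix u z assume uz: "u \<in> A \<inter> W" "z \<in> V" "z \<notin> A \<inter> W" "z \<noteq> v" "z \<noteq> x"
        then show "\<not> E u z" using W(9)[of u z] A(9)[of u z] assms(5) pZ by (cases "z = p") auto
      qed (use A W assms(2,5) yv in auto)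
      then show False using minimal_fragmentD(2)[OF assms(1)] assms(2) A(4) by blast
    qed
    moreover have "?B \<inter> W = {}"
    proof (rule ccontr)
      assume ne: "?B \<inter> W \<noteq> {}"
      have "fragment (?B \<inter> W) v y"
      proof (rule fragmentI[OF ne])
        fix u z assume uz: "u \<in> ?B \<inter> W" "z \<in> V" "z \<notin> ?B \<inter> W" "z \<noteq> v" "z \<noteq> y"
        then show "\<not> E u z" using W(9)[of u z] A(10)[of z u] assms(4) pZ by (cases "z = p") auto
      next
        show "V - ?B \<inter> W - {v, y} \<noteq> {}" using assms(4) W(3) xp(1) W(7) by blast
      qed (use A W assms(2,5) yv in auto)
      then show False using minimal_fragmentD(2)[OF assms(1)] assms(2) A(4) by blast
    qed
    ultimately have "W = {v}" using False assms(2) W(2) by blast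
    then have "neighbors V E v \<subseteq> {x, y}"
      using W(9)[of v] E_irrefl by (auto simp: neighbors_def)
    then show False using degree_gt_2[of v x y] W(2) assms(2) by blast
  qed
qed

text \<open>Both sides of a cut through \<open>v\<close> must contain \<open>x\<close> or
  \<open>y\<close> by the one-sided case, hence one each, and the two-sided case applies.\<close>

lemma minimal_fragment_not_in_cut:
  assumes "minimal_fragment W x y" "v \<in> W" "fragment A v p"
  shows False
proof -
  let ?B = "V - A - {v, p}"
  have B: "fragment ?B v p" using fragment_compl[OF assms(3)] .
  note W = fragmentD[OF minimal_fragmentD(1)[OF assms(1)]]
  note A = fragmentD[OF assms(3)]
  have A1: "x \<in> A \<or> y \<in> A"
    using minimal_fragment_no_cut_one_sided[OF assms] by blast
  have B1: "x \<in> ?B \<or> y \<in> ?B"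
    using minimal_fragment_no_cut_one_sided[OF assms(1,2) B] by blast
  show False
    using minimal_fragment_no_cut_two_sided[OF assms]
      minimal_fragment_no_cut_two_sided[OF minimal_fragment_commute[OF assms(1)] assms(2,3)] A1 B1 by blast
qed

text \<open>This is what minimality is for: \<open>v\<close> can be precolored along with any other
  vertex. If it fails, the vertices reachable from \<open>u\<close> form a fragment for
  \<open>v\<close>, \<open>p\<close>.\<close>

lemma reach_minus_minimal_fragment_vertex:
  assumes "minimal_fragment W x y" "v \<in> W" "p \<in> V" "u \<in> V - {v, p}" "w \<in> V - {v, p}"
  shows "reach (V - {v, p}) E u w"
proof (cases "v = p")
  case True
  then show ?thesis using no_cutvertex[of p u w] assms by simp
next
  case False
  note W = fragmentD[OF minimal_fragmentD(1)[OF assms(1)]]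
  show ?thesis
  proof (rule ccontr)
    assume no: "\<not> ?thesis"
    let ?A = "{z \<in> V - {v, p}. reach (V - {v, p}) E u z}"
    have "fragment ?A v p"
    proof (rule fragmentI)
      show "?A \<noteq> {}" using assms(4) by auto
      show "V - ?A - {v, p} \<noteq> {}" using no assms(5) by auto
      fix a z assume az: "a \<in> ?A" "z \<in> V" "z \<notin> ?A" "z \<noteq> v" "z \<noteq> p"
      show "\<not> E a z"
      proof
        assume "E a z"
        then have "reach (V - {v, p}) E u z"
          using az by (intro rtranclp.rtrancl_into_rtrancl[of _ u a z]) auto
        then show False using az by auto
      qed
    qed (use assms W False in auto)
    then show False using minimal_fragment_not_in_cut[OF assms(1,2)] by blast
  qed
qed

text \<open>If \<open>v\<close> were the only neighbor of \<open>x\<close> in \<open>W\<close>, then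
  \<open>W - {v}\<close> would be a smaller fragment for \<open>v\<close>, \<open>y\<close>; it is
  nonempty because \<open>v\<close> has degree at least 3.\<close>

lemma minimal_fragment_second_neighbor:
  assumes "minimal_fragment W x y"
  shows "\<exists>u\<in>W. u \<noteq> v \<and> E x u"
proof (rule ccontr)
  assume no: "\<not> ?thesis"
  note W = fragmentD[OF minimal_fragmentD(1)[OF assms(1)]]
  obtain u where u: "u \<in> W" "E x u" using fragment_boundary_neighbor minimal_fragmentD(1)[OF assms] by blast
  then have v: "v \<in> W" "E x v" using no by auto
  have only: "\<not> E u x" if "u \<in> W - {v}" for u using that no E_sym by blast
  show False
  proof (cases "W = {v}")
    case True
    then have "neighbors V E v \<subseteq> {x, y}"
      using W(9)[of v] E_irrefl by (auto simp: neighbors_def)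
    then show False using degree_gt_2[of v x y] W(2) v by blast
  next
    case False
    have "fragment (W - {v}) v y"
    proof (rule fragmentI)
      fix a z assume "a \<in> W - {v}" "z \<in> V" "z \<notin> W - {v}" "z \<noteq> v" "z \<noteq> y"
      then show "\<not> E a z" using W(9)[of a z] only by (cases "z = x") auto
    qed (use W v False in auto)
    then show False using minimal_fragmentD(2)[OF assms] v by blast
  qed
qed

text \<open>A nonempty closed part of \<open>W\<close> is a fragment for the same pair. In this form
  the connectedness of \<open>W\<close> is an induction principle: whatever passes along its edges
  holds on all of it.\<close>

lemma minimal_fragment_connected:
  assumes "minimal_fragment W x y" "U \<noteq> {}" "U \<subseteq> W"
    and "\<And>u v. u \<in> U \<Longrightarrow> v \<in> W \<Longrightarrow> E u v \<Longrightarrow> v \<in> U"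
  shows "U = W"
proof (rule ccontr)
  assume ne: "U \<noteq> W"
  note W = fragmentD[OF minimal_fragmentD(1)[OF assms(1)]]
  have "fragment U x y"
  proof (rule fragmentI[OF assms(2)])
    fix u v assume "u \<in> U" "v \<in> V" "v \<notin> U" "v \<noteq> x" "v \<noteq> y"
    then show "\<not> E u v" using W(9)[of u v] assms(3,4) by blast
  qed (use W assms(3) in auto)
  then show False using minimal_fragmentD(2)[OF assms(1)] assms(3) ne by blast
qed

end

section \<open>Good pairs\<close>

locale biconnected_regular_lists = biconnected_regular V E k
  for V :: "'a set" and E :: "'a \<Rightarrow> 'a \<Rightarrow> bool" and k :: nat +
  fixes L :: "'a \<Rightarrow> 'c set"
  assumes finite_L: "v \<in> V \<Longrightarrow> finite (L v)" and card_L: "v \<in> V \<Longrightarrow> card (L v) = k"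
begin

text \<open>
  A good pair consists of a vertex and a color of its list that is wasted on one of its neighbors:
  giving the vertex this color leaves that neighbor with more colors than uncolored neighbors.
\<close>

definition good :: "'a \<Rightarrow> 'c \<Rightarrow> bool" where
  "good u c \<longleftrightarrow> u \<in> V \<and> c \<in> L u \<and> (\<exists>w\<in>V. E u w \<and> c \<notin> L w)"

abbreviation col :: "('a \<Rightarrow> 'c) \<Rightarrow> bool" where
  "col \<equiv> coloring V E L"

abbreviation equiv_col :: "('a \<Rightarrow> 'c) \<Rightarrow> ('a \<Rightarrow> 'c) \<Rightarrow> bool"  (infix "\<approx>" 50) where
  "equiv_col \<equiv> kempe_equiv V E L"

lemma lists_differ:
  assumes "u \<in> V" "v \<in> V" "L u \<noteq> L v"
  shows "\<exists>c\<in>L u. c \<notin> L v"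
  using assms card_subset_eq[of "L v" "L u"] finite_L card_L by (metis subsetI)

lemma equiv_trans: "\<phi> \<approx> \<psi> \<Longrightarrow> \<psi> \<approx> \<chi> \<Longrightarrow> \<phi> \<approx> \<chi>"
  by (rule rtranclp_trans)

lemma good_class:
  assumes "good p c"
  shows "\<exists>\<phi>. col \<phi> \<and> \<phi> p = c"
    and "col \<phi> \<Longrightarrow> col \<psi> \<Longrightarrow> \<phi> p = c \<Longrightarrow> \<psi> p = c \<Longrightarrow> \<phi> \<approx> \<psi>"
proof -
  obtain q where q: "p \<in> V" "c \<in> L p" "q \<in> V" "E p q" "c \<notin> L q" using assms by (auto simp: good_def)
  have "\<exists>t\<in>V - {p}. reach (V - {p}) E v t \<and> (\<exists>s\<in>{p}. E t s \<and> (\<lambda>_. c) s \<notin> L t)" if "v \<in> V - {p}" for v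
    using no_cutvertex[of p v q] q that E_sym E_irrefl by (intro bexI[of _ q]) auto
  note * = kempe_equiv_if_precolored[OF finite_V sym_E irrefl_E, of L "{p}" "\<lambda>_. c", OF _ _ _ this]
  have f: "coloring {p} E L (\<lambda>_. c)" using q E_irrefl by (auto simp: coloring_def)
  show "\<exists>\<phi>. col \<phi> \<and> \<phi> p = c" using *(1)[OF _ _ f] finite_L card_L degree q by auto
  show "col \<phi> \<Longrightarrow> col \<psi> \<Longrightarrow> \<phi> p = c \<Longrightarrow> \<psi> p = c \<Longrightarrow> \<phi> \<approx> \<psi>"
    using *(2)[OF _ _ f] finite_L card_L degree q by auto
qed

text \<open>Both vertices are precolored at once. As the rest is connected, one neighbor
  \<open>t\<close> of either vertex that wastes the color is slack enough. The coloring obtained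
  links the classes of two good pairs.\<close>

lemma good_pairs_meet:
  assumes "v \<in> V" "p \<in> V" "v \<noteq> p" "a \<in> L v" "c \<in> L p" "\<not> (E v p \<and> a = c)"
    and con: "\<And>u w. u \<in> V - {v, p} \<Longrightarrow> w \<in> V - {v, p} \<Longrightarrow> reach (V - {v, p}) E u w"
    and t: "t \<in> V - {v, p}" "E v t \<and> a \<notin> L t \<or> E p t \<and> c \<notin> L t"
  shows "\<exists>\<phi>. col \<phi> \<and> \<phi> v = a \<and> \<phi> p = c"
proof -
  define f where "f = (\<lambda>z. if z = v then a else c)"
  have "\<exists>t\<in>V - {v, p}. reach (V - {v, p}) E u t \<and> (\<exists>s\<in>{v, p}. E t s \<and> f s \<notin> L t)"
    if "u \<in> V - {v, p}" for u
    using con[OF that t(1)] t assms(3) E_sym by (intro bexI[of _ t]) (auto simp: f_def)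
  note * = kempe_equiv_if_precolored(1)[OF finite_V sym_E irrefl_E, of L "{v, p}" f, OF _ _ _ this]
  have f: "coloring {v, p} E L f"
    using assms(3-6) E_irrefl E_sym by (auto simp: coloring_def f_def)
  have "\<exists>\<phi>. col \<phi> \<and> (\<forall>s\<in>{v, p}. \<phi> s = f s)" using assms finite_L card_L degree by (intro *[OF _ _ f]) auto
  then show ?thesis using assms(3) by (auto simp: f_def)
qed

text \<open>
  The swap that gives \<^term>\<open>r\<close> the color \<^term>\<open>c\<close> fails only at a vertex of the Kempe component whose
  list lacks one of the two colors; its predecessor on a path from \<^term>\<open>r\<close> is then good.
\<close>

lemma recolor_or_good:
  assumes "col \<phi>" "r \<in> V" "c \<in> L r"
  shows "(\<exists>\<psi>. col \<psi> \<and> \<phi> \<approx> \<psi> \<and> \<psi> r = c) \<or> (\<exists>z. good z (\<phi> z) \<and> \<phi> z \<in> {\<phi> r, c})"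
proof (rule disjCI)
  assume no: "\<not> (\<exists>z. good z (\<phi> z) \<and> \<phi> z \<in> {\<phi> r, c})"
  let ?U = "{v \<in> V. \<phi> v \<in> {\<phi> r, c}}"
  let ?T = "{v. reach ?U E r v}"
  have TU: "?T \<subseteq> ?U"
  proof
    fix v assume "v \<in> ?T"
    then have "reach ?U E r v" by simp
    then show "v \<in> ?U" by (rule reach_stays) (use assms in auto)
  qed
  have val: "\<phi> r \<in> L v \<and> c \<in> L v" if "v \<in> ?T" for v
  proof -
    have "reach ?U E r v" using that by simp
    then show ?thesis
    proof (induction rule: rtranclp_induct)
      case base
      then show ?case using coloringD(1)[OF assms(1,2)] assms(3) by simp
    next
      case (step u v)
      then have uv: "u \<in> V" "v \<in> V" "E u v" "\<phi> u \<in> {\<phi> r, c}" "\<phi> v \<in> {\<phi> r, c}" by auto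
      have "\<phi> u \<in> L u" "\<phi> v \<in> L v" "\<phi> u \<noteq> \<phi> v" using coloringD[OF assms(1)] uv by auto
      moreover have "\<not> good u (\<phi> u)" using no uv by blast
      ultimately have "\<phi> u \<in> L v" using uv by (auto simp: good_def)
      then show ?case using uv \<open>\<phi> u \<noteq> \<phi> v\<close> \<open>\<phi> v \<in> L v\<close> by auto
    qed
  qed
  have "kempe_closed V E \<phi> (\<phi> r) c ?T"
  proof (rule kempe_closedI)
    fix u v assume *: "u \<in> ?T" "v \<in> V" "E u v" "\<phi> u \<in> {\<phi> r, c}" "\<phi> v \<in> {\<phi> r, c}"
    then have "u \<in> ?U" using TU by blast
    then have "reach ?U E r v" using * by (intro rtranclp.rtrancl_into_rtrancl[of _ r u v]) auto
    then show "v \<in> ?T" by simp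
  qed (use TU in auto)
  then have "kempe_step V E L \<phi> (swap_on (\<phi> r) c ?T \<phi>)"
    using val by (intro kempe_step_swap_on[OF sym_E assms(1)]) auto
  moreover have "swap_on (\<phi> r) c ?T \<phi> r = c" by (simp add: swap_on_def)
  ultimately show "\<exists>\<psi>. col \<psi> \<and> \<phi> \<approx> \<psi> \<and> \<psi> r = c"
    by (intro exI[of _ "swap_on (\<phi> r) c ?T \<phi>"] conjI kempe_step_coloring r_into_rtranclp)
qed

lemma equiv_good:
  assumes "good r c" "col \<phi>"
  shows "\<exists>\<psi> z. col \<psi> \<and> \<phi> \<approx> \<psi> \<and> good z (\<psi> z)"
proof -
  have r: "r \<in> V" "c \<in> L r" using assms(1) by (auto simp: good_def)
  show ?thesis using recolor_or_good[OF assms(2) r]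
  proof
    assume "\<exists>\<psi>. col \<psi> \<and> \<phi> \<approx> \<psi> \<and> \<psi> r = c"
    then show ?thesis using assms(1) by metis
  next
    assume "\<exists>z. good z (\<phi> z) \<and> \<phi> z \<in> {\<phi> r, c}"
    then show ?thesis using assms(2) by blast
  qed
qed

text \<open>Without such an edge the list would be constant on the connected set \<open>W\<close>,
  and \<open>x\<close> and \<open>y\<close> would share it because each has a neighbor in
  \<open>W\<close>.\<close>

lemma minimal_fragment_differing_edge:
  assumes "minimal_fragment W x y" "u \<in> W \<union> {x, y}" "w \<in> W \<union> {x, y}" "L u \<noteq> L w"
  shows "\<exists>v\<in>W. \<exists>v'\<in>W \<union> {x, y}. E v v' \<and> L v \<noteq> L v'"
proof (rule ccontr)
  assume no: "\<not> ?thesis"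
  note W = fragmentD[OF minimal_fragmentD(1)[OF assms(1)]]
  obtain v0 where v0: "v0 \<in> W" using W(1) by blast
  have "{v \<in> W. L v = L v0} = W"
    by (rule minimal_fragment_connected[OF assms(1)]) (use v0 no in auto)
  then have const: "L v = L v0" if "v \<in> W" for v using that by blast
  have "L x = L v0" "L y = L v0"
    using fragment_boundary_neighbor[OF minimal_fragmentD(1)[OF assms(1)]]
      fragment_boundary_neighbor[OF minimal_fragmentD(1)[OF minimal_fragment_commute[OF assms(1)]]]
      const no E_sym by (metis UnI2 insertI1 insertI2)+
  then have "L u = L v0" "L w = L v0" using const assms(2,3) by auto
  then show False using assms(4) by simp
qed

text \<open>
  Two disjoint minimal fragments that both meet an edge with differing lists: the good pairs inside
  them form a hub, since a vertex of a minimal fragment lies in no separating pair.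
\<close>

lemma kempe_connected_two_varying_fragments:
  assumes W1: "minimal_fragment W x y" and W2: "minimal_fragment W2 x2 y2"
    and disj: "W2 \<inter> (W \<union> {x, y}) = {}"
    and e1: "v1 \<in> W" "w1 \<in> W \<union> {x, y}" "E v1 w1" "L v1 \<noteq> L w1"
    and e2: "v2 \<in> W2" "w2 \<in> W2 \<union> {x2, y2}" "E v2 w2" "L v2 \<noteq> L w2"
  shows "kempe_connected V E L"
proof -
  note W = fragmentD[OF minimal_fragmentD(1)[OF W1]]
  note W' = fragmentD[OF minimal_fragmentD(1)[OF W2]]
  have inV: "v1 \<in> V" "w1 \<in> V" "v2 \<in> V" "w2 \<in> V" using W(2,3,5) W'(2,3,5) e1 e2 by auto
  have nadj: "\<not> E v u" "\<not> E u v" "v \<noteq> u" if "v \<in> W" "u \<in> W2" for u v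
    using W(9,10)[of v u] W'(2) disj that by auto
  have meet: "\<exists>\<phi>. col \<phi> \<and> \<phi> v = a \<and> \<phi> p = c"
    if "minimal_fragment U r s" "v \<in> U" "a \<in> L v" "p \<in> V" "c \<in> L p" "p \<noteq> v" "\<not> (E v p \<and> a = c)"
      "t \<in> V" "t \<noteq> v" "t \<noteq> p" "E v t \<and> a \<notin> L t \<or> E p t \<and> c \<notin> L t" for U r s v a p c t
  proof (rule good_pairs_meet[where t = t])
    show "reach (V - {v, p}) E u w" if "u \<in> V - {v, p}" "w \<in> V - {v, p}" for u w
      using reach_minus_minimal_fragment_vertex[OF \<open>minimal_fragment U r s\<close> \<open>v \<in> U\<close> \<open>p \<in> V\<close> that] .
    show "v \<in> V" using fragmentD(2)[OF minimal_fragmentD(1)[OF that(1)]] that(2) by blast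
  qed (use that in auto)
  obtain a2 where a2: "a2 \<in> L v2" "a2 \<notin> L w2" using lists_differ[of v2 w2] inV e2 by blast
  have g2: "good v2 a2" using a2 e2 inV by (auto simp: good_def)
  obtain \<phi>0 where \<phi>0: "col \<phi>0" "\<phi>0 v2 = a2" using good_class(1)[OF g2] by blast
  \<comment> \<open>For a good pair, one realizing coloring in the class of \<open>\<phi>0\<close>
    brings all its realizing colorings into that class.\<close>
  define hub where "hub = (\<lambda>p c. \<exists>\<phi>. col \<phi> \<and> \<phi> p = c \<and> \<phi>0 \<approx> \<phi>)"
  have hub_good: "\<phi>0 \<approx> \<phi>" if h: "hub p c" "good p c" "col \<phi>" "\<phi> p = c" for p c \<phi>
  proof -
    obtain \<chi> where "col \<chi>" "\<chi> p = c" "\<phi>0 \<approx> \<chi>" using h(1) unfolding hub_def by blast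
    then show ?thesis using good_class(2)[OF h(2), of \<chi> \<phi>] h(3,4) equiv_trans by blast
  qed
  have hub_meet: "hub p c" if "hub v a" "good v a" "\<exists>\<phi>. col \<phi> \<and> \<phi> v = a \<and> \<phi> p = c" for p c v a
    using hub_good[OF that(1,2)] that(3) unfolding hub_def by blast
  have hub2: "hub v2 a2" using \<phi>0 unfolding hub_def by blast
  have hub_W: "hub v a" if v: "v \<in> W" "good v a" for v a
  proof -
    \<comment> \<open>No edge joins \<open>v\<close> to \<open>v2\<close>, so the two colors cannot
      clash, and \<open>w2\<close> differs from \<open>v\<close> and can supply the slack.\<close>
    have "\<exists>\<phi>. col \<phi> \<and> \<phi> v2 = a2 \<and> \<phi> v = a"
    proof (rule meet[OF W2 e2(1) a2(1), where t = w2])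
      show "w2 \<noteq> v" using nadj v(1) e2 by blast
      show "w2 \<noteq> v2" using e2 E_irrefl by blast
    qed (use v nadj[OF v(1) e2(1)] inV e2 a2 good_def in auto)
    then show ?thesis using hub_meet[OF hub2 g2] by blast
  qed
  have link: "hub p c" if "v \<in> W" "w \<in> V" "E v w" "a \<in> L v" "a \<notin> L w" "good p c" "p \<noteq> v" "p \<noteq> w" "\<not> (E v p \<and> a = c)"
    for v w a p c
  proof -
    have gv: "good v a" using that W(2) by (auto simp: good_def)
    have "\<exists>\<phi>. col \<phi> \<and> \<phi> v = a \<and> \<phi> p = c"
      by (rule meet[OF W1 that(1), where t = w]) (use that E_irrefl good_def in auto)
    then show ?thesis using hub_meet[OF hub_W[OF that(1) gv] gv] by blast
  qed
  \<comment> \<open>This isolates the only pairs that may escape the hub: \<open>W\<close> has one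
    list throughout, \<open>p\<close> is the boundary vertex that shares it, and the other boundary
    vertex has a different list without \<open>c\<close>.\<close>
  have key: "W \<subseteq> {v. L v = L v1} \<and> p \<in> {x, y} \<and> L p = L v1 \<and> c \<in> L v1 \<and>
      (\<forall>q\<in>{x, y}. q \<noteq> p \<longrightarrow> L q \<noteq> L v1 \<and> c \<notin> L q)" if un: "good p c" "\<not> hub p c" for p c
  proof -
    have pc: "p \<in> V" "c \<in> L p" using un(1) by (auto simp: good_def)
    have pW: "p \<notin> W" using hub_W un by blast
    \<comment> \<open>An edge inside \<open>W\<close> with differing lists gives wasted colors at
      both ends. \<open>link\<close> fails only if the color equals \<open>c\<close>, which cannot
      hold for both, since each is missing from the list at the other end.\<close>
    have inner: "L v = L w" if "v \<in> W" "w \<in> W" "E v w" for v w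
    proof (rule ccontr)
      assume ne: "L v \<noteq> L w"
      have vw: "v \<in> V" "w \<in> V" using that W(2) by auto
      obtain a where a: "a \<in> L v" "a \<notin> L w" using lists_differ[OF vw ne] by blast
      obtain b where b: "b \<in> L w" "b \<notin> L v" using lists_differ[OF vw(2,1) ne[symmetric]] by blast
      have "a = c" using link[OF that(1) vw(2) that(3) a un(1)] that(1,2) un(2) pW by auto
      moreover have "b = c" using link[OF that(2) vw(1) E_sym[OF that(3)] b un(1)] that(1,2) un(2) pW by auto
      ultimately show False using a b by blast
    qed
    have "{v \<in> W. L v = L v1} = W"
      by (rule minimal_fragment_connected[OF W1]) (use inner e1 in auto)
    then have const: "L v = L v1" if "v \<in> W" for v using that by blast
    have not_bd: "p \<noteq> q" if q: "q \<in> {x, y}" "L q \<noteq> L v1" for q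
    proof
      assume "p = q"
      have "\<exists>v\<in>W. v \<noteq> u \<and> E q v" for u
        using minimal_fragment_second_neighbor[OF W1] minimal_fragment_second_neighbor[OF minimal_fragment_commute[OF W1]] q(1)
        by blast
      then obtain v v' where v: "v \<in> W" "E q v" "v' \<in> W" "v' \<noteq> v" "E q v'" by metis
      have vq: "v \<in> V" "q \<in> V" using v(1) W(2) pc \<open>p = q\<close> by auto
      obtain a where a: "a \<in> L v" "a \<notin> L q"
        using lists_differ[OF vq] const[OF v(1)] q(2) by auto
      have gv: "good v a" using a v E_sym W(2) pc \<open>p = q\<close> by (auto simp: good_def)
      obtain t where t: "t \<in> V" "E p t" "c \<notin> L t" using un(1) by (auto simp: good_def)
      \<comment> \<open>The slack vertex must differ from \<open>v\<close>. If \<open>v\<close>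
        itself was to supply it, the second neighbor \<open>v'\<close> of \<open>q\<close> in
        \<open>W\<close>, which has the same list, takes over.\<close>
      obtain t' where t': "t' \<in> V" "t' \<noteq> v" "E p t'" "c \<notin> L t'"
      proof (cases "t = v")
        case True
        then have "c \<notin> L v'" using t const[OF v(1)] const[OF v(3)] by simp
        then show ?thesis using that[of v'] v W(2) \<open>p = q\<close> by blast
      qed (use t that in blast)
      have "\<exists>\<phi>. col \<phi> \<and> \<phi> v = a \<and> \<phi> p = c"
      proof (rule meet[OF W1 v(1), where t = t'])
        show "\<not> (E v p \<and> a = c)" using a pc \<open>p = q\<close> by blast
      qed (use a t' pc \<open>p = q\<close> q v W(2-6) E_irrefl in auto)
      then show False using hub_meet[OF hub_W[OF v(1) gv] gv] un(2) by blast
    qed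
    have w1xy: "w1 \<in> {x, y}" using e1(2,4) const[of w1] by auto
    obtain a1 where a1: "a1 \<in> L v1" "a1 \<notin> L w1" using lists_differ[of v1 w1] inV e1 by blast
    have pw: "p \<noteq> w1" using not_bd[OF w1xy] e1(4) by auto
    have adj: "E v1 p" "a1 = c"
      using link[OF e1(1) inV(2) e1(3) a1 un(1)] e1(1) un(2) pW pw by auto
    then have pxy: "p \<in> {x, y}" using W(9)[of v1 p] e1(1) pc pW by blast
    have "L p = L v1" using not_bd[OF pxy] by blast
    moreover have "q = w1" if "q \<in> {x, y}" "q \<noteq> p" for q using that pxy w1xy pw by auto
    moreover have "W \<subseteq> {v. L v = L v1}" using const by blast
    ultimately show ?thesis using pxy a1 adj(2) e1(4) by (metis (no_types))
  qed
  have all_hub: "hub p c" if un: "good p c" for p c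
  proof (rule ccontr)
    assume nh: "\<not> hub p c"
    note K = key[OF un nh]
    obtain q where q: "q \<in> {x, y}" "q \<noteq> p" using W(7) by blast
    have qV: "q \<in> V" using q W(3,5) by auto
    have Lq: "L q \<noteq> L v1" "c \<notin> L q" using K q by auto
    obtain b where b: "b \<in> L q" "b \<notin> L v1" using lists_differ[of q v1] qV inV Lq by blast
    obtain u where u: "u \<in> W" "E q u"
      using fragment_boundary_neighbor[OF minimal_fragmentD(1)[OF W1]]
        fragment_boundary_neighbor[OF minimal_fragmentD(1)[OF minimal_fragment_commute[OF W1]]] q by blast
    have "L u = L v1" using K u by blast
    then have gq: "good q b" using b qV u W(2) by (auto simp: good_def)
    have hq: "hub q b" using key[OF gq] Lq(1) by blast
    obtain \<phi> where \<phi>: "col \<phi>" "\<phi> p = c" using good_class(1)[OF un] by blast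
    have n\<phi>: "\<not> \<phi>0 \<approx> \<phi>" using nh \<phi> unfolding hub_def by blast
    \<comment> \<open>Giving \<open>q\<close> the color \<open>b\<close> would lead into the hub, so
      this recoloring must be blocked by a good pair outside the hub. By \<open>key\<close> its
      vertex can only be \<open>p\<close>, whose color \<open>c\<close> is neither in the list of
      \<open>q\<close> nor equal to \<open>b\<close>.\<close>
    have "\<not> (\<exists>\<psi>. col \<psi> \<and> \<phi> \<approx> \<psi> \<and> \<psi> q = b)"
    proof
      assume "\<exists>\<psi>. col \<psi> \<and> \<phi> \<approx> \<psi> \<and> \<psi> q = b"
      then obtain \<psi> where "col \<psi>" "\<phi> \<approx> \<psi>" "\<psi> q = b" by blast
      then have "\<phi>0 \<approx> \<psi>" "\<psi> \<approx> \<phi>" using hub_good[OF hq gq] kempe_equiv_sym by auto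
      then show False using n\<phi> equiv_trans by blast
    qed
    then obtain z where z: "good z (\<phi> z)" "\<phi> z \<in> {\<phi> q, b}"
      using recolor_or_good[OF \<phi>(1) qV b(1)] by blast
    have "\<not> hub z (\<phi> z)" using hub_good[OF _ z(1) \<phi>(1)] n\<phi> by blast
    note Kz = key[OF z(1) this]
    have "z = p"
    proof (rule ccontr)
      assume "z \<noteq> p"
      then have "L p \<noteq> L v1" using Kz K by metis
      then show False using K by blast
    qed
    then have "c \<in> {\<phi> q, b}" using z \<phi> by auto
    moreover have "\<phi> q \<in> L q" using coloringD(1)[OF \<phi>(1) qV] .
    ultimately show False using Lq b K by auto
  qed
  show ?thesis
    unfolding kempe_connected_def
  proof (intro conjI allI impI)
    show "\<exists>\<phi>. col \<phi>" using \<phi>0 by blast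
    fix \<phi> \<psi> assume c: "col \<phi>" "col \<psi>"
    have "\<phi>0 \<approx> \<chi>" if \<chi>: "col \<chi>" for \<chi>
    proof -
      obtain \<chi>' z where \<chi>': "col \<chi>'" "\<chi> \<approx> \<chi>'" "good z (\<chi>' z)"
        using equiv_good[OF g2 \<chi>] by blast
      then have "\<phi>0 \<approx> \<chi>'" using hub_good[OF all_hub] by blast
      then show ?thesis using equiv_trans kempe_equiv_sym[OF \<chi>'(2)] by blast
    qed
    then show "\<phi> \<approx> \<psi>" using c equiv_trans[OF kempe_equiv_sym] by blast
  qed
qed

end

section \<open>Separating pairs with a constant side\<close>

definition add_edge :: "'a \<Rightarrow> 'a \<Rightarrow> ('a \<Rightarrow> 'a \<Rightarrow> bool) \<Rightarrow> 'a \<Rightarrow> 'a \<Rightarrow> bool" where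
  "add_edge x y E = (\<lambda>u v. E u v \<or> u = x \<and> v = y \<or> u = y \<and> v = x)"

lemma symp_add_edge: "symp E \<Longrightarrow> symp (add_edge x y E)"
  by (auto simp: symp_def add_edge_def)

lemma irreflp_add_edge: "irreflp E \<Longrightarrow> x \<noteq> y \<Longrightarrow> irreflp (add_edge x y E)"
  by (auto simp: irreflp_def add_edge_def)

lemma coloring_add_edge:
  assumes "x \<in> U" "y \<in> U"
  shows "coloring U (add_edge x y E) L \<phi> \<longleftrightarrow> coloring U E L \<phi> \<and> \<phi> x \<noteq> \<phi> y"
  using assms unfolding coloring_def add_edge_def by auto

lemma coloring_subset: "coloring V E L \<phi> \<Longrightarrow> U \<subseteq> V \<Longrightarrow> coloring U E L \<phi>"
  by (auto simp: coloring_def)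

lemma permutes_two_points:
  assumes "a \<in> M" "b \<in> M" "c \<in> M" "d \<in> M" "a \<noteq> b" "c \<noteq> d"
  shows "\<exists>\<pi>. \<pi> permutes M \<and> \<pi> a = c \<and> \<pi> b = d"
proof (intro exI conjI)
  let ?p = "transpose a c" and ?q = "transpose (transpose a c b) d"
  have "transpose a c b \<in> M" using assms by (auto simp: transpose_def)
  then show "(?q \<circ> ?p) permutes M"
    using assms by (intro permutes_compose permutes_swap_id) auto
  show "(?q \<circ> ?p) a = c" "(?q \<circ> ?p) b = d" using assms by (auto simp: transpose_def)
qed

text \<open>
  A side \<^term>\<open>R\<close> of a separating pair with the same list everywhere: a swap of the other side (with
  the edge between the two vertices added) extends by exchanging the two colors on all of \<^term>\<open>R\<close>.
\<close>

locale constant_side =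
  fixes V :: "'a set" and E :: "'a \<Rightarrow> 'a \<Rightarrow> bool" and L :: "'a \<Rightarrow> 'c set"
    and U R :: "'a set" and x y :: 'a and M :: "'c set"
  assumes sym: "symp E" and V: "V = U \<union> R" "U \<inter> R = {}" and xy: "x \<in> U" "y \<in> U"
    and sep: "\<And>u v. u \<in> R \<Longrightarrow> v \<in> U \<Longrightarrow> E u v \<Longrightarrow> v \<in> {x, y}"
    and const: "\<And>v. v \<in> R \<union> {x, y} \<Longrightarrow> L v = M"
begin

text \<open>By the added edge, if one of \<open>x\<close>, \<open>y\<close> really changes color,
  then so does the other if it has one of the two colors, and no conflict arises in exchanging the
  colors on all of \<open>R\<close>. If neither changes, the swap cannot enter \<open>R\<close>. The
  permutation records the effect on \<open>R\<close>, so that it can be undone later.\<close>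

lemma step_lift:
  assumes \<phi>: "coloring V E L \<phi>" and st: "kempe_step U (add_edge x y E) L \<phi> \<theta>"
  shows "\<exists>\<psi> \<pi>. \<pi> permutes M \<and> kempe_equiv V E L \<phi> \<psi> \<and> (\<forall>v\<in>U. \<psi> v = \<theta> v) \<and>
    (\<forall>v\<in>R \<union> {x, y}. \<psi> v = \<pi> (\<phi> v))"
  using st
proof (elim kempe_stepE)
  fix a b T
  assume T: "kempe_closed U (add_edge x y E) \<phi> a b T" "T \<subseteq> U"
    "\<And>v. v \<in> U \<Longrightarrow> \<theta> v = swap_on a b T \<phi> v"
    "\<And>v. v \<in> T \<Longrightarrow> \<phi> v \<in> {a, b} \<Longrightarrow> a \<in> L v \<and> b \<in> L v"
  have both: "q \<in> T \<Longrightarrow> q \<in> {x, y} \<Longrightarrow> \<phi> q \<in> {a, b} \<Longrightarrow> q' \<in> {x, y} \<Longrightarrow> \<phi> q' \<in> {a, b} \<Longrightarrow> q' \<in> T" for q q'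
    using kempe_closedD(2)[OF T(1), of q q'] xy by (auto simp: add_edge_def)
  have inner: "u \<in> T \<Longrightarrow> v \<in> U \<Longrightarrow> E u v \<Longrightarrow> \<phi> u \<in> {a, b} \<Longrightarrow> \<phi> v \<in> {a, b} \<Longrightarrow> v \<in> T" for u v
    using kempe_closedD(2)[OF T(1), of u v] by (auto simp: add_edge_def)
  show ?thesis
  proof (cases "\<exists>q\<in>{x, y}. q \<in> T \<and> \<phi> q \<in> {a, b}")
    case True
    then obtain q where q: "q \<in> {x, y}" "q \<in> T" "\<phi> q \<in> {a, b}" by blast
    have abM: "a \<in> M" "b \<in> M" using T(4)[OF q(2,3)] const[of q] q(1) by auto
    have cl: "kempe_closed V E \<phi> a b (T \<union> R)"
    proof (rule kempe_closedI)
      fix u v assume *: "u \<in> T \<union> R" "v \<in> V" "E u v" "\<phi> u \<in> {a, b}" "\<phi> v \<in> {a, b}"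
      show "v \<in> T \<union> R"
        using sep[of u v] inner[of u v] both[OF q(2,1,3), of v] * V by blast
    qed (use T(2) V in auto)
    have val: "a \<in> L v \<and> b \<in> L v" if "v \<in> T \<union> R" "\<phi> v \<in> {a, b}" for v
      using that T(4)[of v] const[of v] abM by auto
    have "kempe_step V E L \<phi> (swap_on a b (T \<union> R) \<phi>)"
      by (rule kempe_step_swap_on[OF sym \<phi> cl val])
    moreover have "\<forall>v\<in>U. swap_on a b (T \<union> R) \<phi> v = \<theta> v" using T(3) V by (auto simp: swap_on_def)
    moreover have "\<forall>v\<in>R \<union> {x, y}. swap_on a b (T \<union> R) \<phi> v = transpose a b (\<phi> v)"
      using both[OF q(2,1,3)] by (auto simp: swap_on_def transpose_def)
    moreover have "transpose a b permutes M" using abM by (rule permutes_swap_id)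
    ultimately show ?thesis by (metis r_into_rtranclp)
  next
    case False
    have cl: "kempe_closed V E \<phi> a b T"
    proof (rule kempe_closedI)
      fix u v assume *: "u \<in> T" "v \<in> V" "E u v" "\<phi> u \<in> {a, b}" "\<phi> v \<in> {a, b}"
      show "v \<in> T"
        using sep[of v u] inner[of u v] * V False T(2) sympD[OF sym *(3)] by blast
    qed (use T(2) V in auto)
    have "kempe_step V E L \<phi> (swap_on a b T \<phi>)"
      by (rule kempe_step_swap_on[OF sym \<phi> cl T(4)])
    moreover have "\<forall>v\<in>U. swap_on a b T \<phi> v = \<theta> v" using T(3) by auto
    moreover have "\<forall>v\<in>R \<union> {x, y}. swap_on a b T \<phi> v = id (\<phi> v)"
    proof
      fix v assume v: "v \<in> R \<union> {x, y}"
      show "swap_on a b T \<phi> v = id (\<phi> v)"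
      proof (cases "v \<in> T")
        case True
        then have "v \<in> {x, y}" using v T(2) V by blast
        then have "\<phi> v \<notin> {a, b}" using False True by blast
        then show ?thesis by (auto simp: swap_on_def transpose_def)
      qed (simp add: swap_on_def)
    qed
    moreover have "id permutes M" by (rule permutes_id)
    ultimately show ?thesis by (metis r_into_rtranclp)
  qed
qed

lemma equiv_lift:
  assumes \<phi>: "coloring V E L \<phi>" and eq: "kempe_equiv U (add_edge x y E) L \<phi> \<theta>"
  shows "\<exists>\<psi> \<pi>. \<pi> permutes M \<and> kempe_equiv V E L \<phi> \<psi> \<and> (\<forall>v\<in>U. \<psi> v = \<theta> v) \<and>
    (\<forall>v\<in>R \<union> {x, y}. \<psi> v = \<pi> (\<phi> v))"
proof -
  let ?P = "\<lambda>\<psi>. coloring V E L \<psi> \<and> (\<exists>\<pi>. \<pi> permutes M \<and> (\<forall>v\<in>R \<union> {x, y}. \<psi> v = \<pi> (\<phi> v)))"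
  have "\<exists>\<chi>'. kempe_equiv V E L \<chi> \<chi>' \<and> ?P \<chi>' \<and> (\<forall>v\<in>U. \<chi>' v = \<theta> v)"
    if P: "?P \<chi>" and st: "kempe_step U (add_edge x y E) L \<chi> \<theta>" for \<chi> \<theta>
  proof -
    obtain \<pi> where \<pi>: "\<pi> permutes M" "\<forall>v\<in>R \<union> {x, y}. \<chi> v = \<pi> (\<phi> v)" using P by blast
    obtain \<chi>' \<pi>' where \<chi>': "\<pi>' permutes M" "kempe_equiv V E L \<chi> \<chi>'" "\<forall>v\<in>U. \<chi>' v = \<theta> v"
      "\<forall>v\<in>R \<union> {x, y}. \<chi>' v = \<pi>' (\<chi> v)"
      using step_lift[OF _ st] P by blast
    have "(\<pi>' \<circ> \<pi>) permutes M" using \<pi>(1) \<chi>'(1) by (rule permutes_compose)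
    moreover have "\<forall>v\<in>R \<union> {x, y}. \<chi>' v = (\<pi>' \<circ> \<pi>) (\<phi> v)" using \<pi>(2) \<chi>'(4) by auto
    moreover have "coloring V E L \<chi>'" using kempe_equiv_coloring[OF \<chi>'(2)] P by blast
    ultimately show ?thesis using \<chi>'(2,3) by blast
  qed
  moreover have "?P \<phi>" using \<phi> permutes_id[of M] by (auto intro!: exI[of _ id])
  ultimately have "\<exists>\<psi>. kempe_equiv V E L \<phi> \<psi> \<and> ?P \<psi> \<and> (\<forall>v\<in>U. \<psi> v = \<theta> v)"
    using eq by (rule kempe_equiv_lift)
  then show ?thesis by blast
qed

text \<open>Both colorings distinguish \<open>x\<close> and \<open>y\<close>, so some permutation of
  the common list \<open>M\<close> aligns them at the two vertices. Constant lists make the permuted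
  coloring of \<open>R\<close> admissible.\<close>

lemma glue:
  assumes \<theta>: "coloring U (add_edge x y E) L \<theta>" and \<eta>: "coloring (R \<union> {x, y}) (add_edge x y E) L \<eta>"
  shows "\<exists>\<phi>. coloring V E L \<phi> \<and> (\<forall>v\<in>U. \<phi> v = \<theta> v)"
proof -
  have \<theta>': "coloring U E L \<theta>" "\<theta> x \<noteq> \<theta> y" using \<theta> xy by (simp_all add: coloring_add_edge)
  have \<eta>': "coloring (R \<union> {x, y}) E L \<eta>" "\<eta> x \<noteq> \<eta> y" using \<eta> by (simp_all add: coloring_add_edge)
  have \<eta>M: "\<eta> v \<in> M" if "v \<in> R \<union> {x, y}" for v using coloringD(1)[OF \<eta>'(1) that] const[OF that] by simp
  have \<theta>M: "\<theta> x \<in> M" "\<theta> y \<in> M" using coloringD(1)[OF \<theta>'(1)] xy const by auto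
  obtain \<pi> where \<pi>: "\<pi> permutes M" "\<pi> (\<eta> x) = \<theta> x" "\<pi> (\<eta> y) = \<theta> y"
    using permutes_two_points[of "\<eta> x" M "\<eta> y" "\<theta> x" "\<theta> y"] \<eta>M \<theta>M \<theta>'(2) \<eta>'(2) by auto
  define \<phi> where "\<phi> = (\<lambda>v. if v \<in> U then \<theta> v else \<pi> (\<eta> v))"
  have \<phi>R: "\<phi> v = \<pi> (\<eta> v)" if "v \<in> R \<union> {x, y}" for v using that \<pi> V by (auto simp: \<phi>_def)
  have inj: "\<pi> p = \<pi> q \<longleftrightarrow> p = q" for p q using permutes_inj[OF \<pi>(1)] by (auto dest: injD)
  have R: "\<phi> u \<noteq> \<phi> v" if "u \<in> R" "v \<in> V" "E u v" for u v
  proof -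
    have uv: "u \<in> R \<union> {x, y}" "v \<in> R \<union> {x, y}" using sep[of u v] that V by auto
    then show ?thesis using coloringD(2)[OF \<eta>'(1) uv that(3)] \<phi>R inj by simp
  qed
  have "coloring V E L \<phi>"
    unfolding coloring_def
  proof (intro conjI ballI impI)
    fix v assume v: "v \<in> V"
    show "\<phi> v \<in> L v"
    proof (cases "v \<in> U")
      case True
      then show ?thesis using coloringD(1)[OF \<theta>'(1)] by (simp add: \<phi>_def)
    next
      case False
      then have "v \<in> R \<union> {x, y}" using v V by auto
      then show ?thesis using \<phi>R \<eta>M const permutes_in_image[OF \<pi>(1)] by auto
    qed
  next
    fix u v assume uv: "u \<in> V" "v \<in> V" "E u v"
    show "\<phi> u \<noteq> \<phi> v"
    proof (cases "u \<in> U \<and> v \<in> U")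
      case True
      then show ?thesis using coloringD(2)[OF \<theta>'(1)] uv by (simp add: \<phi>_def)
    next
      case False
      then show ?thesis using R[of u v] R[of v u] sympD[OF sym uv(3)] uv V by force
    qed
  qed
  then show ?thesis by (auto simp: \<phi>_def)
qed

end

section \<open>Removing a side: degree counts and the two reductions\<close>

context biconnected_regular_lists
begin

lemma finite_neighbors: "U \<subseteq> V \<Longrightarrow> finite (neighbors U E v)"
  using finite_V finite_subset by (fastforce simp: neighbors_def)

lemma card_neighbors_split:
  assumes "A \<union> B \<subseteq> V" "A \<inter> B = {}" "v \<in> V"
  shows "card (neighbors A E v) + card (neighbors B E v) \<le> k"
proof -
  have "card (neighbors A E v) + card (neighbors B E v) = card (neighbors A E v \<union> neighbors B E v)"
    using assms finite_neighbors by (intro card_Un_disjoint[symmetric]) (auto simp: neighbors_def)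
  also have "\<dots> \<le> card (neighbors V E v)"
    using assms finite_neighbors by (intro card_mono) (auto simp: neighbors_def)
  finally show ?thesis using degree[OF assms(3)] by simp
qed

lemma neighbors_nonempty_card: "U \<subseteq> V \<Longrightarrow> u \<in> U \<Longrightarrow> E v u \<Longrightarrow> 0 < card (neighbors U E v)"
  using finite_neighbors[of U v] card_gt_0_iff by (auto simp: neighbors_def)

text \<open>The added edge gives \<open>x\<close> and \<open>y\<close> one neighbor more, which is
  balanced by a neighbor lost on the other side. It also connects the side, so slack at one of the
  two vertices suffices.\<close>

lemma fragment_side_kempe_connected:
  assumes A: "fragment A x y"
    and slack: "Suc (card (neighbors A E x)) < k \<or> Suc (card (neighbors A E y)) < k"
  shows "kempe_connected (A \<union> {x, y}) (add_edge x y E) L"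
proof -
  note A' = fragmentD[OF A]
  let ?J = "A \<union> {x, y}" and ?E = "add_edge x y E" and ?B = "V - A - {x, y}"
  have B: "fragment ?B x y" by (rule fragment_compl[OF A])
  have JV: "?J \<subseteq> V" using A' by auto
  have bound: "card (neighbors ?J ?E q) \<le> Suc (card (neighbors A E q))" if "q \<in> {x, y}" for q
  proof -
    have "neighbors ?J ?E q \<subseteq> insert (if q = x then y else x) (neighbors A E q)"
      using that E_irrefl by (auto simp: neighbors_def add_edge_def)
    then have "card (neighbors ?J ?E q) \<le> card (insert (if q = x then y else x) (neighbors A E q))"
      using finite_neighbors[OF A'(2)] by (intro card_mono) auto
    also have "\<dots> \<le> Suc (card (neighbors A E q))" using card_insert_le_m1 by (simp add: card_insert_if finite_neighbors[OF A'(2)])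
    finally show ?thesis .
  qed
  have less: "Suc (card (neighbors A E q)) \<le> k" if q: "q \<in> {x, y}" for q
  proof -
    obtain u where "u \<in> ?B" "E q u"
      using fragment_boundary_neighbor[OF B] fragment_boundary_neighbor[OF fragment_commute[OF B]] q by blast
    then have "0 < card (neighbors ?B E q)" by (intro neighbors_nonempty_card) auto
    moreover have "card (neighbors A E q) + card (neighbors ?B E q) \<le> k"
      using A'(2,3,5) q by (intro card_neighbors_split) auto
    ultimately show ?thesis by linarith
  qed
  have reach_x: "reach ?J ?E v x" if "v \<in> ?J" for v
  proof (cases "v = y")
    case True
    then show ?thesis by (intro r_into_rtranclp) (auto simp: add_edge_def)
  next
    case False
    have "V - ?B - {y} = A \<union> {x}" using A' by auto
    then have "reach (A \<union> {x}) E v x" using fragment_reach[OF B, of v] False that by auto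
    then show ?thesis by (rule reach_mono) (auto simp: add_edge_def)
  qed
  have xy: "reach ?J ?E x y" by (intro r_into_rtranclp) (auto simp: add_edge_def)
  show ?thesis
  proof (rule kempe_connected_if_slack)
    show "finite ?J" using JV finite_V finite_subset by blast
    show "symp ?E" "irreflp ?E" using sym_E irrefl_E A'(7) by (simp_all add: symp_add_edge irreflp_add_edge)
  next
    fix v assume v: "v \<in> ?J"
    have "card (neighbors ?J ?E v) \<le> k"
    proof (cases "v \<in> {x, y}")
      case True
      then show ?thesis using bound[OF True] less[OF True] by linarith
    next
      case False
      then have "neighbors ?J ?E v \<subseteq> neighbors V E v" using JV by (auto simp: neighbors_def add_edge_def)
      then have "card (neighbors ?J ?E v) \<le> card (neighbors V E v)" using finite_neighbors by (intro card_mono) auto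
      then show ?thesis using degree[of v] v JV by auto
    qed
    then show "finite (L v) \<and> card (neighbors ?J ?E v) \<le> card (L v)"
      using finite_L card_L v JV by auto
  next
    fix v assume v: "v \<in> ?J"
    obtain q where q: "q \<in> {x, y}" "Suc (card (neighbors A E q)) < k" using slack by blast
    have "reach ?J ?E v q" using q(1) reach_x[OF v] rtranclp_trans[OF reach_x[OF v] xy] by blast
    moreover have "card (neighbors ?J ?E q) < card (L q)"
      using bound[OF q(1)] q A' card_L by auto
    ultimately show "\<exists>t\<in>?J. reach ?J ?E v t \<and> card (neighbors ?J ?E t) < card (L t)"
      using q(1) by blast
  qed
qed

text \<open>An edge with an end in \<open>W\<close> stays in \<open>W \<union> {x, y}\<close>, where
  all lists agree. Hence colorings that agree off \<open>W\<close> share every good pair that one of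
  them realizes.\<close>

lemma good_outside_constant_fragment:
  assumes "fragment W x y" "\<And>v. v \<in> W \<union> {x, y} \<Longrightarrow> L v = M" "p \<in> V" "q \<in> V" "E p q" "c \<in> L p" "c \<notin> L q"
  shows "p \<notin> W" "q \<notin> W"
proof -
  have False if "p \<in> W \<or> q \<in> W"
  proof -
    have "p \<in> W \<union> {x, y}" "q \<in> W \<union> {x, y}"
      using fragmentD(9)[OF assms(1), of p q] fragmentD(10)[OF assms(1), of q p] assms(3-5) that by blast+
    then show False using assms(2)[of p] assms(2)[of q] assms(6,7) by simp
  qed
  then show "p \<notin> W" "q \<notin> W" by blast+
qed

text \<open>The coloring \<eta> allows every coloring of the reduced graph to be extended over
  \<open>W\<close>. Thus each good pair is realized with different colors at \<open>x\<close> and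
  \<open>y\<close>, and the swaps of the reduced graph connect all such colorings up to the colors
  on \<open>W\<close>.\<close>

lemma kempe_connected_constant_fragment_split:
  assumes W: "minimal_fragment W x y" and const: "\<And>v. v \<in> W \<union> {x, y} \<Longrightarrow> L v = M"
    and g: "good r d" and \<eta>: "coloring (W \<union> {x, y}) (add_edge x y E) L \<eta>"
  shows "kempe_connected V E L"
proof -
  note Wf = minimal_fragmentD(1)[OF W]
  note W' = fragmentD[OF Wf]
  let ?U = "V - W" and ?E = "add_edge x y E" and ?Z = "V - W - {x, y}"
  have UZ: "?Z \<union> {x, y} = ?U" using W' by auto
  interpret side: constant_side V E L ?U W x y M
  proof
    fix u v assume "u \<in> W" "v \<in> ?U" "E u v"
    then show "v \<in> {x, y}" using W'(9)[of u v] by blast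
  qed (use W'(2-7) sym_E const in auto)
  \<comment> \<open>Two neighbors lost at \<open>x\<close> pay for the added edge and still leave a
    color to spare.\<close>
  have two: "2 \<le> card (neighbors W E x)"
  proof -
    obtain u u' where "u \<in> W" "E x u" "u' \<in> W" "u' \<noteq> u" "E x u'"
      using minimal_fragment_second_neighbor[OF W] by metis
    then have "{u, u'} \<subseteq> neighbors W E x" by (auto simp: neighbors_def)
    from card_mono[OF finite_neighbors[OF W'(2)] this] show ?thesis using \<open>u' \<noteq> u\<close> by simp
  qed
  have con: "kempe_connected ?U ?E L"
  proof -
    have "card (neighbors W E x) + card (neighbors ?Z E x) \<le> k"
      using W' by (intro card_neighbors_split) auto
    then have "Suc (card (neighbors ?Z E x)) < k" using two by linarith
    then show ?thesis using fragment_side_kempe_connected[OF fragment_compl[OF Wf]] UZ by simp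
  qed
  have symE': "symp ?E" "irreflp ?E" using sym_E irrefl_E W'(7) by (simp_all add: symp_add_edge irreflp_add_edge)
  have split: "\<exists>\<phi>. col \<phi> \<and> \<phi> p = c \<and> \<phi> x \<noteq> \<phi> y" if pc: "good p c" for p c
  proof -
    obtain q where q: "p \<in> V" "c \<in> L p" "q \<in> V" "E p q" "c \<notin> L q" using pc by (auto simp: good_def)
    have pq: "p \<notin> W" "q \<notin> W" "q \<noteq> p"
      using good_outside_constant_fragment[OF Wf const q(1,3,4,2,5)] q E_irrefl by auto
    have con_p: "reach (?U - {p}) ?E u q" if u: "u \<in> ?U - {p}" for u
    proof (cases "p \<in> {x, y}")
      case True
      have *: "reach (?U - {p}) ?E z z'" if "z \<in> ?U - {p}" "p \<in> {x, y}" "z' \<in> {x, y}" "z' \<noteq> p" for z z'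
        using reach_mono[OF fragment_reach[OF Wf, of z], of "?U - {p}" ?E]
          reach_mono[OF fragment_reach[OF fragment_commute[OF Wf], of z], of "?U - {p}" ?E] that
        by (auto simp: add_edge_def)
      obtain z' where z': "z' \<in> {x, y}" "z' \<noteq> p" using W'(7) True by blast
      have "reach (?U - {p}) ?E u z'" "reach (?U - {p}) ?E q z'"
        using *[OF u True z'] *[OF _ True z', of q] pq q by auto
      then show ?thesis using rtranclp_trans[OF _ reach_sym[OF symE'(1)]] by blast
    next
      case False
      then have xyU: "x \<in> ?U - {p}" "y \<in> ?U - {p}" using W' by auto
      have xy: "reach (?U - {p}) ?E x y" "reach (?U - {p}) ?E y x"
        using xyU by (auto intro!: r_into_rtranclp simp: add_edge_def)
      have "reach (V - {p}) E u q" using u q pq by (intro no_cutvertex) auto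
      \<comment> \<open>A walk that enters \<open>W\<close> leaves it through \<open>x\<close> or
        \<open>y\<close>, and these are adjacent in \<open>?E\<close>. While the walk is inside
        \<open>W\<close>, the claim is therefore kept at \<open>x\<close>.\<close>
      then have "(u \<notin> W \<longrightarrow> reach (?U - {p}) ?E u q) \<and> (u \<in> W \<longrightarrow> reach (?U - {p}) ?E x q)"
      proof (induction rule: converse_rtranclp_induct)
        case base
        then show ?case using pq by auto
      next
        case (step u w)
        have xr: "reach (?U - {p}) ?E z q \<longleftrightarrow> reach (?U - {p}) ?E x q" if "z \<in> {x, y}" for z
          using rtranclp_trans[OF xy(1), of q] rtranclp_trans[OF xy(2), of q] that by blast
        show ?case
        proof (cases "w \<in> W")
          case True
          then have "u \<notin> W \<Longrightarrow> u \<in> {x, y}" using W'(10)[of w u] step(1) by blast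
          then show ?thesis using step.IH True xr by blast
        next
          case False
          then have IH: "reach (?U - {p}) ?E w q" using step.IH by blast
          show ?thesis
          proof (cases "u \<in> W")
            case True
            then have "w \<in> {x, y}" using W'(9)[of u w] step(1) False by blast
            then show ?thesis using IH xr True by blast
          next
            case uW: False
            then have "reach (?U - {p}) ?E u q"
              using step(1) False by (intro converse_rtranclp_into_rtranclp[OF _ IH]) (auto simp: add_edge_def)
            then show ?thesis using uW by blast
          qed
        qed
      qed
      then show ?thesis using u by blast
    qed
    have "\<exists>\<theta>. coloring ?U ?E L \<theta> \<and> (\<forall>s\<in>{p}. \<theta> s = (\<lambda>_. c) s)"
    proof (rule kempe_equiv_if_precolored(1))
      show "finite ?U" using finite_V by auto
      fix v assume v: "v \<in> ?U"
      have "card (neighbors ?U ?E v) \<le> k"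
      proof (cases "v \<in> {x, y}")
        case True
        let ?o = "if v = x then y else x"
        have "neighbors ?U ?E v \<subseteq> insert ?o (neighbors ?U E v)" using True by (auto simp: neighbors_def add_edge_def)
        then have "card (neighbors ?U ?E v) \<le> card (insert ?o (neighbors ?U E v))"
          using finite_neighbors[of ?U] by (intro card_mono) auto
        also have "\<dots> \<le> Suc (card (neighbors ?U E v))" by (simp add: card_insert_if finite_neighbors)
        finally have "card (neighbors ?U ?E v) \<le> Suc (card (neighbors ?U E v))" .
        moreover obtain u where "u \<in> W" "E v u"
          using fragment_boundary_neighbor[OF Wf] fragment_boundary_neighbor[OF fragment_commute[OF Wf]] True by blast
        then have "0 < card (neighbors W E v)" using W'(2) by (intro neighbors_nonempty_card) auto
        moreover have "card (neighbors W E v) + card (neighbors ?U E v) \<le> k"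
          using W'(2) v by (intro card_neighbors_split) auto
        ultimately show ?thesis by linarith
      next
        case False
        then have "neighbors ?U ?E v \<subseteq> neighbors V E v" by (auto simp: neighbors_def add_edge_def)
        then have "card (neighbors ?U ?E v) \<le> card (neighbors V E v)" using finite_neighbors by (intro card_mono) auto
        then show ?thesis using degree[of v] v by auto
      qed
      then show "finite (L v) \<and> card (neighbors ?U ?E v) \<le> card (L v)" using finite_L card_L v by auto
    next
      show "coloring {p} ?E L (\<lambda>_. c)" using q W'(7) E_irrefl by (auto simp: coloring_def add_edge_def)
      fix v assume v: "v \<in> ?U - {p}"
      show "\<exists>t\<in>?U - {p}. reach (?U - {p}) ?E v t \<and> (\<exists>s\<in>{p}. ?E t s \<and> c \<notin> L t)"
        using con_p[OF v] q pq E_sym by (intro bexI[of _ q]) (auto simp: add_edge_def)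
    qed (use symE' q pq in auto)
    then obtain \<theta> where \<theta>: "coloring ?U ?E L \<theta>" "\<theta> p = c" by auto
    obtain \<phi> where \<phi>: "col \<phi>" "\<forall>v\<in>?U. \<phi> v = \<theta> v" using side.glue[OF \<theta>(1) \<eta>] by blast
    have "\<theta> x \<noteq> \<theta> y" using \<theta>(1) W'(3-6) by (auto simp: coloring_add_edge)
    then show ?thesis using \<phi> \<theta>(2) W'(3-6) q pq by (intro exI[of _ \<phi>]) auto
  qed
  show ?thesis
    unfolding kempe_connected_def
  proof (intro conjI allI impI)
    show "\<exists>\<phi>. col \<phi>" using split[OF g] by blast
    have to_split: "\<exists>\<psi> z. col \<psi> \<and> \<chi> \<approx> \<psi> \<and> good z (\<psi> z) \<and> \<psi> x \<noteq> \<psi> y" if \<chi>: "col \<chi>" for \<chi>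
    proof -
      obtain \<chi>1 z where 1: "col \<chi>1" "\<chi> \<approx> \<chi>1" "good z (\<chi>1 z)" using equiv_good[OF g \<chi>] by blast
      obtain \<chi>2 where 2: "col \<chi>2" "\<chi>2 z = \<chi>1 z" "\<chi>2 x \<noteq> \<chi>2 y" using split[OF 1(3)] by blast
      have "\<chi>1 \<approx> \<chi>2" using good_class(2)[OF 1(3) 1(1) 2(1)] 2(2) by simp
      then show ?thesis using 1 2 equiv_trans by metis
    qed
    fix \<phi> \<psi> assume c: "col \<phi>" "col \<psi>"
    obtain \<phi>1 where \<phi>1: "col \<phi>1" "\<phi> \<approx> \<phi>1" "\<phi>1 x \<noteq> \<phi>1 y" using to_split[OF c(1)] by blast
    obtain \<psi>1 z where \<psi>1: "col \<psi>1" "\<psi> \<approx> \<psi>1" "good z (\<psi>1 z)" "\<psi>1 x \<noteq> \<psi>1 y" using to_split[OF c(2)] by blast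
    have "coloring ?U ?E L \<phi>1" "coloring ?U ?E L \<psi>1"
      using coloring_subset[OF \<phi>1(1), of ?U] coloring_subset[OF \<psi>1(1), of ?U] \<phi>1(3) \<psi>1(4) W'(3-6)
      by (auto simp: coloring_add_edge)
    then have "kempe_equiv ?U ?E L \<phi>1 \<psi>1" using con by (auto simp: kempe_connected_def)
    then obtain \<chi> where \<chi>: "\<phi>1 \<approx> \<chi>" "\<forall>v\<in>?U. \<chi> v = \<psi>1 v" using side.equiv_lift[OF \<phi>1(1)] by blast
    have z: "z \<in> ?U"
      using \<psi>1(3) good_outside_constant_fragment(1)[OF Wf const, of z] by (auto simp: good_def)
    \<comment> \<open>The two colorings may still differ on \<open>W\<close>, but both realize the
      good pair at \<open>z\<close>, which lies outside \<open>W\<close>.\<close>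
    have "\<chi> \<approx> \<psi>1"
      using good_class(2)[OF \<psi>1(3) kempe_equiv_coloring[OF \<chi>(1) \<phi>1(1)] \<psi>1(1)] \<chi>(2) z by simp
    then show "\<phi> \<approx> \<psi>" using equiv_trans[OF \<phi>1(2) equiv_trans[OF \<chi>(1) equiv_trans[OF _ kempe_equiv_sym[OF \<psi>1(2)]]]] by blast
  qed
qed

text \<open>If the side cannot distinguish \<open>x\<close> and \<open>y\<close>, the slack
  criterion must fail on it, so each of them has at least \<open>k - 1\<close> neighbors in
  \<open>W\<close> and exactly one outside. Every coloring agrees at \<open>x\<close> and
  \<open>y\<close>, so \<open>x\<close> can act for \<open>y\<close>.\<close>

lemma kempe_connected_constant_fragment_rigid:
  assumes Wf: "fragment W x y" and const: "\<And>v. v \<in> W \<union> {x, y} \<Longrightarrow> L v = M"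
    and g: "good r d" and rigid: "\<nexists>\<eta>. coloring (W \<union> {x, y}) (add_edge x y E) L \<eta>"
  shows "kempe_connected V E L"
proof -
  note W' = fragmentD[OF Wf]
  let ?Z = "V - W - {x, y}"
  have big: "k \<le> Suc (card (neighbors W E q))" if "q \<in> {x, y}" for q
  proof (rule ccontr)
    assume "\<not> k \<le> Suc (card (neighbors W E q))"
    then have "Suc (card (neighbors W E x)) < k \<or> Suc (card (neighbors W E y)) < k" using that by auto
    then show False
      using fragment_side_kempe_connected[OF Wf] rigid unfolding kempe_connected_def by blast
  qed
  have unique: "\<exists>q'\<in>?Z. E q q' \<and> neighbors (V - W) E q = {q'}" if q: "q \<in> {x, y}" for q
  proof -
    note Z = fragment_compl[OF Wf]
    obtain q' where q': "q' \<in> ?Z" "E q q'"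
      using fragment_boundary_neighbor[OF Z] fragment_boundary_neighbor[OF fragment_commute[OF Z]] q by blast
    have "card (neighbors W E q) + card (neighbors (V - W) E q) \<le> k"
      using W' q by (intro card_neighbors_split) auto
    then have le: "card (neighbors (V - W) E q) \<le> 1" using big[OF q] by linarith
    have sub: "{q'} \<subseteq> neighbors (V - W) E q" using q' by (auto simp: neighbors_def)
    have "neighbors (V - W) E q = {q'}"
      by (rule sym, rule card_seteq[OF _ sub]) (use le finite_neighbors[of "V - W" q] in auto)
    then show ?thesis using q' by blast
  qed
  obtain x' where x': "x' \<in> ?Z" "E x x'" "neighbors (V - W) E x = {x'}" using unique[of x] by auto
  obtain y' where y': "y' \<in> ?Z" "E y y'" "neighbors (V - W) E y = {y'}" using unique[of y] by auto
  \<comment> \<open>Since \<open>y\<close> always has the color of \<open>x\<close>, its only outer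
    neighbor \<open>y'\<close> is joined to \<open>x\<close> when \<open>y\<close> is
    removed.\<close>
  let ?U = "V - W - {y}" and ?E = "add_edge x y' E"
  have xy': "x \<in> ?U" "y' \<in> ?U" "x \<noteq> y'" using W' y' by auto
  have eq: "\<phi> x = \<phi> y" if \<phi>: "col \<phi>" for \<phi>
  proof (rule ccontr)
    assume "\<phi> x \<noteq> \<phi> y"
    then have "coloring (W \<union> {x, y}) (add_edge x y E) L \<phi>"
      using coloring_subset[OF \<phi>, of "W \<union> {x, y}"] W'(2-6) by (auto simp: coloring_add_edge)
    then show False using rigid by blast
  qed
  have con: "kempe_connected ?U ?E L"
  proof (rule kempe_connected_if_slack)
    show "finite ?U" using finite_V by auto
    show "symp ?E" "irreflp ?E" using sym_E irrefl_E xy'(3) by (simp_all add: symp_add_edge irreflp_add_edge)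
    fix v assume v: "v \<in> ?U"
    \<comment> \<open>At most two neighbors remain at \<open>x\<close>, against at least three
      colors; this is the slack. The vertex \<open>y'\<close> trades its neighbor \<open>y\<close>
      for \<open>x\<close>, so its degree does not grow.\<close>
    have nx: "neighbors ?U ?E x \<subseteq> {x', y'}"
      using x'(3) xy' by (auto simp: neighbors_def add_edge_def)
    have two: "card {x', y'} \<le> 2" by (simp add: card_insert_if)
    have dx: "card (neighbors ?U ?E x) < k"
      using card_mono[OF _ nx] two k_ge_3 by force
    have "card (neighbors ?U ?E v) \<le> k"
    proof (cases "v = x")
      case True
      then show ?thesis using dx by simp
    next
      case vx: False
      show ?thesis
      proof (cases "v = y'")
        case True
        have "neighbors ?U ?E y' \<subseteq> insert x (neighbors V E y' - {y})"
          by (auto simp: neighbors_def add_edge_def)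
        then have "card (neighbors ?U ?E y') \<le> card (insert x (neighbors V E y' - {y}))"
          using finite_neighbors by (intro card_mono) auto
        also have "\<dots> \<le> Suc (card (neighbors V E y' - {y}))"
          by (simp add: card_insert_if finite_neighbors)
        also have "\<dots> = card (neighbors V E y')"
          using y' E_sym W' finite_neighbors[of V y'] by (intro card_Suc_Diff1) (auto simp: neighbors_def)
        finally show ?thesis using degree[of y'] y' True by auto
      next
        case False
        then have "neighbors ?U ?E v \<subseteq> neighbors V E v" using vx by (auto simp: neighbors_def add_edge_def)
        then have "card (neighbors ?U ?E v) \<le> card (neighbors V E v)" using finite_neighbors by (intro card_mono) auto
        then show ?thesis using degree[of v] v by auto
      qed
    qed
    then show "finite (L v) \<and> card (neighbors ?U ?E v) \<le> card (L v)" using finite_L card_L v by auto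
    have "reach ?U ?E v x" using fragment_reach[OF Wf v] by (rule reach_mono) (auto simp: add_edge_def)
    then show "\<exists>t\<in>?U. reach ?U ?E v t \<and> card (neighbors ?U ?E t) < card (L t)"
      using dx xy'(1) card_L by auto
  qed
  have lift: "\<exists>\<psi>. \<phi> \<approx> \<psi> \<and> col \<psi> \<and> (\<forall>v\<in>?U. \<psi> v = \<theta> v)"
    if \<phi>: "col \<phi>" and st: "kempe_step ?U ?E L \<phi> \<theta>" for \<phi> \<theta>
    using st
  proof (elim kempe_stepE)
    fix a b T
    assume T: "kempe_closed ?U ?E \<phi> a b T" "T \<subseteq> ?U"
      "\<And>v. v \<in> ?U \<Longrightarrow> \<theta> v = swap_on a b T \<phi> v"
      "\<And>v. v \<in> T \<Longrightarrow> \<phi> v \<in> {a, b} \<Longrightarrow> a \<in> L v \<and> b \<in> L v"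
    have inner: "u \<in> T \<Longrightarrow> v \<in> ?U \<Longrightarrow> E u v \<Longrightarrow> \<phi> u \<in> {a, b} \<Longrightarrow> \<phi> v \<in> {a, b} \<Longrightarrow> v \<in> T" for u v
      using kempe_closedD(2)[OF T(1), of u v] by (auto simp: add_edge_def)
    have xT: "x \<in> T \<Longrightarrow> \<phi> x \<in> {a, b} \<Longrightarrow> \<phi> y' \<in> {a, b} \<Longrightarrow> y' \<in> T"
      "y' \<in> T \<Longrightarrow> \<phi> x \<in> {a, b} \<Longrightarrow> \<phi> y' \<in> {a, b} \<Longrightarrow> x \<in> T"
      using kempe_closedD(2)[OF T(1), of x y'] kempe_closedD(2)[OF T(1), of y' x] xy' by (auto simp: add_edge_def)
    have yn: "u = y'" if "u \<in> ?U" "E y u" for u using y'(3) that by (auto simp: neighbors_def)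
    have Wn: "u = x" if "w \<in> W" "u \<in> ?U" "E w u" for u w using W'(9)[of w u] that by blast
    have fin: "\<exists>\<psi>. \<phi> \<approx> \<psi> \<and> col \<psi> \<and> (\<forall>v\<in>?U. \<psi> v = \<theta> v)"
      if "kempe_closed V E \<phi> a b T'" "T' \<inter> ?U = T" "\<And>v. v \<in> T' \<Longrightarrow> \<phi> v \<in> {a, b} \<Longrightarrow> a \<in> L v \<and> b \<in> L v" for T'
    proof -
      have st': "kempe_step V E L \<phi> (swap_on a b T' \<phi>)" by (rule kempe_step_swap_on[OF sym_E \<phi> that(1,3)])
      moreover have "\<forall>v\<in>?U. swap_on a b T' \<phi> v = \<theta> v" using T(3) that(2) by (auto simp: swap_on_def)
      ultimately show ?thesis using kempe_step_coloring by (metis r_into_rtranclp)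
    qed
    show ?thesis
    proof (cases "x \<in> T \<and> \<phi> x \<in> {a, b}")
      case True
      show ?thesis
      proof (rule fin[of "T \<union> W \<union> {y}"])
        show "kempe_closed V E \<phi> a b (T \<union> W \<union> {y})"
        proof (rule kempe_closedI)
          fix u v assume *: "u \<in> T \<union> W \<union> {y}" "v \<in> V" "E u v" "\<phi> u \<in> {a, b}" "\<phi> v \<in> {a, b}"
          show "v \<in> T \<union> W \<union> {y}"
            using inner[of u v] yn[of v] Wn[of u v] xT(1) True * by blast
        qed (use T(2) W'(2,5) in auto)
        show "(T \<union> W \<union> {y}) \<inter> ?U = T" using T(2) by auto
        show "a \<in> L v \<and> b \<in> L v" if "v \<in> T \<union> W \<union> {y}" "\<phi> v \<in> {a, b}" for v
          using T(4)[of v] T(4)[of x] that True const[of v] const[of x] by auto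
      qed
    next
      case False
      show ?thesis
      proof (rule fin[of T])
        show "kempe_closed V E \<phi> a b T"
        proof (rule kempe_closedI)
          fix u v assume *: "u \<in> T" "v \<in> V" "E u v" "\<phi> u \<in> {a, b}" "\<phi> v \<in> {a, b}"
          have uU: "u \<in> ?U" using * T(2) by blast
          have "v \<notin> W" using Wn[of v u] uU E_sym[OF *(3)] False * by blast
          \<comment> \<open>The swap could reach \<open>y\<close> only from \<open>y'\<close>; but
            then the color of \<open>x\<close>, which is that of \<open>y\<close>, is in the pair,
            and the added edge puts \<open>x\<close> into \<open>T\<close>.\<close>
          moreover have "v \<noteq> y"
          proof
            assume "v = y"
            then have "u = y'" "\<phi> x \<in> {a, b}" using yn[OF uU] E_sym[OF *(3)] eq[OF \<phi>] *(5) by auto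
            then show False using xT(2) * False by blast
          qed
          ultimately show "v \<in> T" using inner[of u v] * by blast
        qed (use T(2) in auto)
      qed (use T(2,4) in auto)
    qed
  qed
  show ?thesis
    unfolding kempe_connected_def
  proof (intro conjI allI impI)
    show "\<exists>\<phi>. col \<phi>" using good_class(1)[OF g] by blast
    fix \<phi> \<psi> assume c: "col \<phi>" "col \<psi>"
    obtain \<psi>1 z where \<psi>1: "col \<psi>1" "\<psi> \<approx> \<psi>1" "good z (\<psi>1 z)" using equiv_good[OF g c(2)] by blast
    have res: "coloring ?U ?E L \<chi>" if \<chi>: "col \<chi>" for \<chi>
    proof -
      have "\<chi> x \<noteq> \<chi> y'" using eq[OF \<chi>] coloringD(2)[OF \<chi> _ _ y'(2)] W'(5) y'(1) by auto
      then show ?thesis using coloring_subset[OF \<chi>, of ?U] xy' by (auto simp: coloring_add_edge)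
    qed
    have "kempe_equiv ?U ?E L \<phi> \<psi>1" using con res c(1) \<psi>1(1) by (auto simp: kempe_connected_def)
    then obtain \<chi> where \<chi>: "\<phi> \<approx> \<chi>" "col \<chi>" "\<forall>v\<in>?U. \<chi> v = \<psi>1 v"
      using kempe_equiv_lift[where P = col, OF lift c(1)] by blast
    have z: "z \<in> V - W"
      using \<psi>1(3) good_outside_constant_fragment(1)[OF Wf const, of z] by (auto simp: good_def)
    have "\<chi> y = \<psi>1 y" using eq[OF \<chi>(2)] eq[OF \<psi>1(1)] \<chi>(3) xy'(1) by auto
    then have "\<chi> z = \<psi>1 z" using \<chi>(3) z by (cases "z = y") auto
    then have "\<chi> \<approx> \<psi>1" using good_class(2)[OF \<psi>1(3) \<chi>(2) \<psi>1(1)] by simp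
    then show "\<phi> \<approx> \<psi>" using equiv_trans[OF \<chi>(1) equiv_trans[OF _ kempe_equiv_sym[OF \<psi>1(2)]]] by blast
  qed
qed

end

section \<open>Constant lists\<close>

context biconnected_regular_lists
begin

text \<open>Two colors that avoid \<open>x\<close> and \<open>y\<close> cannot leave
  \<open>A\<close>, so exchanging them on all of \<open>A\<close> is a step, and permutations are
  composed of such exchanges.\<close>

lemma equiv_permute_side:
  assumes \<psi>: "col \<psi>" and A: "fragment A x y" and const: "\<And>v. v \<in> A \<Longrightarrow> L v = M"
    and "\<pi> permutes N" "finite N" "N \<subseteq> M - {\<psi> x, \<psi> y}"
  shows "\<psi> \<approx> (\<lambda>v. if v \<in> A then \<pi> (\<psi> v) else \<psi> v)"
  using assms(4,5)
proof (induction rule: permutes_induct)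
  case id
  show ?case by (rule r_into_rtranclp, rule kempe_step_agree[OF \<psi>]) auto
next
  case (swap a b p)
  note A' = fragmentD[OF A]
  let ?\<chi> = "\<lambda>v. if v \<in> A then p (\<psi> v) else \<psi> v"
  have \<chi>: "col ?\<chi>" using kempe_equiv_coloring[OF swap.IH \<psi>] .
  have cl: "kempe_closed V E ?\<chi> a b A"
  proof (rule kempe_closedI[OF A'(2)])
    fix u v assume uv: "u \<in> A" "v \<in> V" "E u v" and v: "?\<chi> v \<in> {a, b}"
    have "v \<noteq> x" "v \<noteq> y" using v swap.hyps(1,2) assms(6) A'(4,6) by auto
    then show "v \<in> A" using A'(9)[of u v] uv by blast
  qed
  have "kempe_step V E L ?\<chi> (swap_on a b A ?\<chi>)"
    by (rule kempe_step_swap_on[OF sym_E \<chi> cl]) (use const swap.hyps(1,2) assms(6) in auto)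
  moreover have "swap_on a b A ?\<chi> = (\<lambda>v. if v \<in> A then (transpose a b \<circ> p) (\<psi> v) else \<psi> v)"
    by (auto simp: swap_on_def)
  ultimately show ?case using swap.IH by (metis rtranclp.rtrancl_into_rtrancl)
qed

text \<open>
  The swap of \<^term>\<open>a\<close> and \<^term>\<open>b\<close> at \<^term>\<open>x\<close> does not reach \<^term>\<open>y\<close> through the side
  \<^term>\<open>S\<close>.
\<close>

definition unlinked :: "'a \<Rightarrow> 'a \<Rightarrow> 'c \<Rightarrow> ('a \<Rightarrow> 'c) \<Rightarrow> 'a set \<Rightarrow> 'c \<Rightarrow> bool" where
  "unlinked x y a \<phi> S b \<longleftrightarrow> (\<exists>T\<subseteq>S. (\<forall>u\<in>S. E x u \<longrightarrow> \<phi> u = b \<longrightarrow> u \<in> T) \<and>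
     (\<forall>u\<in>T. \<forall>w\<in>S. E u w \<longrightarrow> \<phi> u \<in> {a, b} \<longrightarrow> \<phi> w \<in> {a, b} \<longrightarrow> w \<in> T) \<and>
     (\<forall>u\<in>T. E y u \<longrightarrow> \<phi> u \<noteq> b))"

lemma unlinkedE:
  assumes "unlinked x y a \<phi> S b"
  obtains T where "T \<subseteq> S" "\<And>u. u \<in> S \<Longrightarrow> E x u \<Longrightarrow> \<phi> u = b \<Longrightarrow> u \<in> T"
    "\<And>u w. u \<in> T \<Longrightarrow> w \<in> S \<Longrightarrow> E u w \<Longrightarrow> \<phi> u \<in> {a, b} \<Longrightarrow> \<phi> w \<in> {a, b} \<Longrightarrow> w \<in> T"
    "\<And>u. u \<in> T \<Longrightarrow> E y u \<Longrightarrow> \<phi> u \<noteq> b"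
proof -
  from assms obtain T where T: "T \<subseteq> S" "\<forall>u\<in>S. E x u \<longrightarrow> \<phi> u = b \<longrightarrow> u \<in> T"
    "\<forall>u\<in>T. \<forall>w\<in>S. E u w \<longrightarrow> \<phi> u \<in> {a, b} \<longrightarrow> \<phi> w \<in> {a, b} \<longrightarrow> w \<in> T"
    "\<forall>u\<in>T. E y u \<longrightarrow> \<phi> u \<noteq> b"
    unfolding unlinked_def by (elim exE conjE)
  show thesis
    by (rule that[OF T(1) T(2)[rule_format] T(3)[rule_format] T(4)[rule_format]])
qed

text \<open>Without a neighbor of \<open>x\<close> of color \<open>b\<close>, the empty set is a
  witness for \<open>unlinked\<close>; without such a neighbor of \<open>y\<close>, all of
  \<open>S\<close> is.\<close>

lemma linked_neighbors:
  assumes "\<not> unlinked x y a \<phi> S b"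
  shows "\<exists>u\<in>S. E x u \<and> \<phi> u = b" "\<exists>u\<in>S. E y u \<and> \<phi> u = b"
proof -
  show "\<exists>u\<in>S. E x u \<and> \<phi> u = b"
  proof (rule ccontr)
    assume "\<not> ?thesis"
    then have "unlinked x y a \<phi> S b" unfolding unlinked_def by (intro exI[of _ "{}"]) auto
    then show False using assms by blast
  qed
  show "\<exists>u\<in>S. E y u \<and> \<phi> u = b"
  proof (rule ccontr)
    assume "\<not> ?thesis"
    then have "unlinked x y a \<phi> S b" unfolding unlinked_def by (intro exI[of _ S]) auto
    then show False using assms by blast
  qed
qed

text \<open>If all \<open>k - 1\<close> colors other than \<open>a\<close> were linked, each would
  occur on a neighbor of \<open>x\<close> and on a neighbor of \<open>y\<close> in
  \<open>S\<close>.\<close>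

lemma unlinked_color_exists:
  assumes "S \<subseteq> V" "finite M" "card M = k" "a \<in> M"
    and small: "Suc (card (neighbors S E x)) < k \<or> Suc (card (neighbors S E y)) < k"
  shows "\<exists>b\<in>M - {a}. unlinked x y a \<phi> S b"
proof (rule ccontr)
  assume no: "\<not> ?thesis"
  have "k \<le> Suc (card (neighbors S E q))" if q: "q \<in> {x, y}" for q
  proof -
    have "M - {a} \<subseteq> \<phi> ` neighbors S E q"
    proof
      fix b assume "b \<in> M - {a}"
      then have "\<not> unlinked x y a \<phi> S b" using no by blast
      then obtain u where "u \<in> S" "E q u" "\<phi> u = b" using linked_neighbors[of x y a \<phi> S b] q by blast
      then show "b \<in> \<phi> ` neighbors S E q" by (auto simp: neighbors_def)
    qed
    then have "card (M - {a}) \<le> card (\<phi> ` neighbors S E q)"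
      using finite_neighbors[OF assms(1)] by (intro card_mono) auto
    also have "\<dots> \<le> card (neighbors S E q)" using finite_neighbors[OF assms(1)] by (rule card_image_le)
    finally show ?thesis using assms(2-4) by (simp add: card_Diff_singleton)
  qed
  then show False using small by (metis insertCI linorder_not_le)
qed

text \<open>
  If \<open>x\<close> and \<open>y\<close> have the same color \<open>a\<close>, some \<open>b\<close> does not link them through the side \<open>A\<close> and
  some \<open>b'\<close> does not link them through the side \<open>B\<close>; exchanging \<open>b\<close> and \<open>b'\<close> on \<open>A\<close> produces a
  color that links them through neither side.
\<close>

lemma separate_pair:
  assumes A: "fragment A x y" and const: "\<And>v. v \<in> V \<Longrightarrow> L v = M"
    and smallA: "Suc (card (neighbors A E x)) < k \<or> Suc (card (neighbors A E y)) < k"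
    and smallB: "Suc (card (neighbors (V - A - {x, y}) E x)) < k \<or> Suc (card (neighbors (V - A - {x, y}) E y)) < k"
    and \<phi>: "col \<phi>" and eq: "\<phi> x = \<phi> y"
  shows "\<exists>\<psi>. \<phi> \<approx> \<psi> \<and> \<psi> x \<noteq> \<psi> y"
proof -
  note A' = fragmentD[OF A]
  let ?B = "V - A - {x, y}"
  define a where "a = \<phi> x"
  have M: "finite M" "card M = k" "a \<in> M"
    using finite_L[OF A'(3)] card_L[OF A'(3)] const[OF A'(3)] coloringD(1)[OF \<phi> A'(3)] by (auto simp: a_def)
  obtain b where b: "b \<in> M" "b \<noteq> a" "unlinked x y a \<phi> A b"
    using unlinked_color_exists[OF A'(2) M smallA] by blast
  obtain b' where b': "b' \<in> M" "b' \<noteq> a" "unlinked x y a \<phi> ?B b'"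
    using unlinked_color_exists[OF _ M smallB] by blast
  let ?\<chi> = "swap_on b b' A \<phi>"
  have clA: "kempe_closed V E \<phi> b b' A"
  proof (rule kempe_closedI[OF A'(2)])
    fix u v assume "u \<in> A" "v \<in> V" "E u v" "\<phi> u \<in> {b, b'}" and v: "\<phi> v \<in> {b, b'}"
    moreover have "v \<noteq> x" "v \<noteq> y" using v b(2) b'(2) eq by (auto simp: a_def)
    ultimately show "v \<in> A" using A'(9)[of u v] by blast
  qed
  have st1: "kempe_step V E L \<phi> ?\<chi>"
    by (rule kempe_step_swap_on[OF sym_E \<phi> clA]) (use const A'(2) b b' in auto)
  have \<chi>: "col ?\<chi>" by (rule kempe_step_coloring[OF st1])
  have out: "?\<chi> v = \<phi> v" if "v \<notin> A" for v using that by (simp add: swap_on_def)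
  \<comment> \<open>On \<open>A\<close>, the color \<open>b'\<close> of the new coloring stands
    where \<open>b\<close> stood before, while \<open>a\<close> is unmoved. Hence \<open>TA\<close>,
    found for \<open>b\<close>, now serves \<open>b'\<close>, as \<open>TB\<close> does on the other
    side.\<close>
  have ins: "?\<chi> v = b' \<longleftrightarrow> \<phi> v = b" "?\<chi> v = a \<longleftrightarrow> \<phi> v = a" if "v \<in> A" for v
    using that b(2) b'(2) by (auto simp: swap_on_def transpose_def)
  have xy: "?\<chi> x = a" "?\<chi> y = a" using out A'(4,6) eq by (auto simp: a_def)
  obtain TA where TA: "TA \<subseteq> A" "\<And>u. u \<in> A \<Longrightarrow> E x u \<Longrightarrow> \<phi> u = b \<Longrightarrow> u \<in> TA"
    "\<And>u w. u \<in> TA \<Longrightarrow> w \<in> A \<Longrightarrow> E u w \<Longrightarrow> \<phi> u \<in> {a, b} \<Longrightarrow> \<phi> w \<in> {a, b} \<Longrightarrow> w \<in> TA"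
    "\<And>u. u \<in> TA \<Longrightarrow> E y u \<Longrightarrow> \<phi> u \<noteq> b"
    using b(3) by (elim unlinkedE) (rule that; assumption)
  obtain TB where TB: "TB \<subseteq> ?B" "\<And>u. u \<in> ?B \<Longrightarrow> E x u \<Longrightarrow> \<phi> u = b' \<Longrightarrow> u \<in> TB"
    "\<And>u w. u \<in> TB \<Longrightarrow> w \<in> ?B \<Longrightarrow> E u w \<Longrightarrow> \<phi> u \<in> {a, b'} \<Longrightarrow> \<phi> w \<in> {a, b'} \<Longrightarrow> w \<in> TB"
    "\<And>u. u \<in> TB \<Longrightarrow> E y u \<Longrightarrow> \<phi> u \<noteq> b'"
    using b'(3) by (elim unlinkedE) (rule that; assumption)
  let ?T = "insert x (TA \<union> TB)"
  have cl: "kempe_closed V E ?\<chi> a b' ?T"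
  proof (rule kempe_closedI)
    fix u v assume uv: "u \<in> ?T" "v \<in> V" "E u v" "?\<chi> u \<in> {a, b'}" "?\<chi> v \<in> {a, b'}"
    have uV: "u \<in> V" using uv(1) TA(1) TB(1) A' by auto
    have ne: "?\<chi> u \<noteq> ?\<chi> v" using coloringD(2)[OF \<chi> uV uv(2,3)] .
    have vu: "E v u" using E_sym[OF uv(3)] .
    consider "v = x" | "v = y" | "v \<in> A" | "v \<in> ?B" using uv(2) by blast
    then show "v \<in> ?T"
    proof cases
      case 2
      then have u: "?\<chi> u = b'" "u \<noteq> x" using ne uv(4) xy by auto
      have False
      proof (cases "u \<in> TA")
        case True
        then have "\<phi> u = b" using ins(1)[of u] TA(1) u(1) by blast
        then show False using TA(4)[OF True] vu 2 by blast
      next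
        case False
        then have "u \<in> TB" using uv(1) u(2) by blast
        then show False using TB(4)[of u] out[of u] TB(1) u(1) vu 2 by auto
      qed
      then show ?thesis ..
    next
      case 3
      show ?thesis
      proof (cases "u = x")
        case True
        then have "\<phi> v = b" using ne xy uv(5) ins(1)[OF 3] by auto
        then show ?thesis using TA(2)[OF 3] uv(3) True by blast
      next
        case False
        then have "u \<in> A" using A'(9)[of v u] 3 vu uV uv(1) TB(1) TA(1) by blast
        then have "u \<in> TA" using uv(1) TB(1) False by blast
        moreover have "\<phi> u \<in> {a, b}" "\<phi> v \<in> {a, b}"
          using ins[OF \<open>u \<in> A\<close>] ins[OF 3] uv(4,5) by auto
        ultimately show ?thesis using TA(3)[of u v] 3 uv(3) by blast
      qed
    next
      case 4
      then have \<phi>v: "\<phi> v \<in> {a, b'}" using uv(5) out[of v] by auto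
      show ?thesis
      proof (cases "u = x")
        case True
        then have "\<phi> v = b'" using ne xy out[of v] 4 \<phi>v by auto
        then show ?thesis using TB(2)[OF 4] uv(3) True by blast
      next
        case False
        then have "u \<notin> A" using A'(9)[of u v] 4 uv(3) by blast
        then have "u \<in> TB" using uv(1) TA(1) False by blast
        moreover have "\<phi> u \<in> {a, b'}" using uv(4) out[OF \<open>u \<notin> A\<close>] by simp
        ultimately show ?thesis using TB(3)[of u v] 4 uv(3) \<phi>v by blast
      qed
    qed simp
  qed (use TA(1) TB(1) A' in auto)
  have st2: "kempe_step V E L ?\<chi> (swap_on a b' ?T ?\<chi>)"
    by (rule kempe_step_swap_on[OF sym_E \<chi> cl])
      (use const M(3) b'(1) kempe_closedD(1)[OF cl] in blast)
  have "y \<notin> ?T" using TA(1) TB(1) A'(6,7) by auto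
  then have "swap_on a b' ?T ?\<chi> y = a" "swap_on a b' ?T ?\<chi> x = b'"
    using xy by (auto simp: swap_on_def transpose_def)
  then have "swap_on a b' ?T ?\<chi> x \<noteq> swap_on a b' ?T ?\<chi> y" using b'(2) by simp
  moreover have "\<phi> \<approx> swap_on a b' ?T ?\<chi>"
    by (rule converse_rtranclp_into_rtranclp[of "kempe_step V E L"], rule st1, rule r_into_rtranclp, rule st2)
  ultimately show ?thesis by blast
qed

lemma kempe_connected_constant_unbalanced:
  assumes A: "fragment A x y" and const: "\<And>v. v \<in> V \<Longrightarrow> L v = M"
    and smallA: "Suc (card (neighbors A E x)) < k \<or> Suc (card (neighbors A E y)) < k"
    and smallB: "Suc (card (neighbors (V - A - {x, y}) E x)) < k \<or> Suc (card (neighbors (V - A - {x, y}) E y)) < k"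
  shows "kempe_connected V E L"
proof -
  note A' = fragmentD[OF A]
  let ?B = "V - A - {x, y}" and ?E = "add_edge x y E"
  have conA: "kempe_connected (A \<union> {x, y}) ?E L"
    by (rule fragment_side_kempe_connected[OF A smallA])
  have conB: "kempe_connected (?B \<union> {x, y}) ?E L"
    by (rule fragment_side_kempe_connected[OF fragment_compl[OF A] smallB])
  interpret a: constant_side V E L "?B \<union> {x, y}" A x y M
  proof
    fix u v assume "u \<in> A" "v \<in> ?B \<union> {x, y}" "E u v"
    then show "v \<in> {x, y}" using A'(9)[of u v] by blast
  qed (use A'(2-7) sym_E const in auto)
  interpret b: constant_side V E L "A \<union> {x, y}" ?B x y M
  proof
    fix u v assume "u \<in> ?B" "v \<in> A \<union> {x, y}" "E u v"
    then show "v \<in> {x, y}" using A'(10)[of v u] by blast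
  qed (use A'(2-7) sym_E const in auto)
  have restrict: "coloring U ?E L \<phi>" if "col \<phi>" "\<phi> x \<noteq> \<phi> y" "{x, y} \<subseteq> U" "U \<subseteq> V" for U \<phi>
    using coloring_subset[OF that(1,4)] that(2,3) by (auto simp: coloring_add_edge)
  have diff: "\<phi> \<approx> \<psi>" if \<phi>: "col \<phi>" "\<phi> x \<noteq> \<phi> y" and \<psi>: "col \<psi>" "\<psi> x \<noteq> \<psi> y" for \<phi> \<psi>
  proof -
    have "kempe_equiv (?B \<union> {x, y}) ?E L \<phi> \<psi>"
      using conB restrict[OF \<phi>, of "?B \<union> {x, y}"] restrict[OF \<psi>, of "?B \<union> {x, y}"] A'(3,5)
      by (auto simp: kempe_connected_def)
    then obtain \<phi>1 where \<phi>1: "\<phi> \<approx> \<phi>1" "\<forall>v\<in>?B \<union> {x, y}. \<phi>1 v = \<psi> v"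
      using a.equiv_lift[OF \<phi>(1)] by blast
    have c1: "col \<phi>1" "\<phi>1 x \<noteq> \<phi>1 y" using kempe_equiv_coloring[OF \<phi>1(1) \<phi>(1)] \<phi>1(2) \<psi>(2) by auto
    have "kempe_equiv (A \<union> {x, y}) ?E L \<phi>1 \<psi>"
      using conA restrict[OF c1, of "A \<union> {x, y}"] restrict[OF \<psi>, of "A \<union> {x, y}"] A'(2,3,5)
      by (auto simp: kempe_connected_def)
    then obtain \<phi>2 \<pi> where \<phi>2: "\<pi> permutes M" "\<phi>1 \<approx> \<phi>2" "\<forall>v\<in>A \<union> {x, y}. \<phi>2 v = \<psi> v"
      "\<forall>v\<in>?B \<union> {x, y}. \<phi>2 v = \<pi> (\<phi>1 v)"
      using b.equiv_lift[OF c1(1)] by blast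
    have \<pi>\<psi>: "\<phi>2 v = \<pi> (\<psi> v)" if "v \<in> ?B \<union> {x, y}" for v using \<phi>2(4) \<phi>1(2) that by auto
    \<comment> \<open>At \<open>x\<close> and \<open>y\<close> the final coloring agrees with the
      target, so \<pi> fixes their two colors. It moves only colors that can be permuted on
      \<open>?B\<close> alone, and the damage done there by the second lift is undone.\<close>
    have fix': "\<pi> (\<psi> x) = \<psi> x" "\<pi> (\<psi> y) = \<psi> y" using \<pi>\<psi>[of x] \<pi>\<psi>[of y] \<phi>2(3) by auto
    let ?N = "M - {\<psi> x, \<psi> y}"
    have perm: "\<pi> permutes ?N" by (rule permutes_superset[OF \<phi>2(1)]) (use fix' in auto)
    have "finite ?N" using finite_L[OF A'(3)] const[OF A'(3)] by simp
    then have p1: "\<psi> \<approx> (\<lambda>v. if v \<in> ?B then \<pi> (\<psi> v) else \<psi> v)"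
      by (intro equiv_permute_side[OF \<psi>(1) fragment_compl[OF A] _ perm, of M]) (use const in auto)
    have p2: "\<phi>2 \<approx> (\<lambda>v. if v \<in> ?B then \<pi> (\<psi> v) else \<psi> v)"
    proof (rule r_into_rtranclp, rule kempe_step_agree)
      show "col \<phi>2" using kempe_equiv_coloring[OF \<phi>2(2) c1(1)] .
      show "(if v \<in> ?B then \<pi> (\<psi> v) else \<psi> v) = \<phi>2 v" if "v \<in> V" for v
        using \<pi>\<psi>[of v] \<phi>2(3) that by auto
    qed
    have "\<phi>2 \<approx> \<psi>" by (rule equiv_trans[OF p2 kempe_equiv_sym[OF p1]])
    then show ?thesis using equiv_trans[OF \<phi>1(1) equiv_trans[OF \<phi>2(2)]] by blast
  qed
  show ?thesis
    unfolding kempe_connected_def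
  proof (intro conjI allI impI)
    show "\<exists>\<phi>. col \<phi>" using a.glue conA conB unfolding kempe_connected_def by blast
    have sep: "\<exists>\<psi>. \<phi> \<approx> \<psi> \<and> \<psi> x \<noteq> \<psi> y" if "col \<phi>" for \<phi>
      using separate_pair[OF A const smallA smallB that] by (cases "\<phi> x = \<phi> y") auto
    fix \<phi> \<psi> assume c: "col \<phi>" "col \<psi>"
    obtain \<phi>1 where \<phi>1: "\<phi> \<approx> \<phi>1" "\<phi>1 x \<noteq> \<phi>1 y" using sep[OF c(1)] by blast
    obtain \<psi>1 where \<psi>1: "\<psi> \<approx> \<psi>1" "\<psi>1 x \<noteq> \<psi>1 y" using sep[OF c(2)] by blast
    have "\<phi>1 \<approx> \<psi>1"
      using diff[OF kempe_equiv_coloring[OF \<phi>1(1) c(1)] \<phi>1(2) kempe_equiv_coloring[OF \<psi>1(1) c(2)] \<psi>1(2)] .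
    then show "\<phi> \<approx> \<psi>" using equiv_trans[OF \<phi>1(1) equiv_trans[OF _ kempe_equiv_sym[OF \<psi>1(1)]]] by blast
  qed
qed

text \<open>
  If \<open>x\<close> and \<open>y\<close> both have a single neighbor outside \<open>A\<close>, replacing \<open>y\<close> by that neighbor gives a
  separating pair to which the previous lemma applies.
\<close>

lemma kempe_connected_constant_balanced:
  assumes A: "fragment A x y" and const: "\<And>v. v \<in> V \<Longrightarrow> L v = M"
    and big: "k \<le> Suc (card (neighbors A E x))" "k \<le> Suc (card (neighbors A E y))"
  shows "kempe_connected V E L"
proof -
  note A' = fragmentD[OF A]
  let ?B = "V - A - {x, y}"
  have one: "card (neighbors (V - A) E q) \<le> 1" if q: "q \<in> {x, y}" for q
  proof -
    have "card (neighbors A E q) + card (neighbors (V - A) E q) \<le> k"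
      using A'(2,3,5) q by (intro card_neighbors_split) auto
    then show ?thesis using big q by auto
  qed
  obtain y' where y': "y' \<in> ?B" "E y y'"
    using fragment_boundary_neighbor[OF fragment_commute[OF fragment_compl[OF A]]] by blast
  have yn: "u = y'" if "u \<in> V - A" "E y u" for u
  proof -
    have "{u, y'} \<subseteq> neighbors (V - A) E y" using that y' by (auto simp: neighbors_def)
    then have "card {u, y'} \<le> card (neighbors (V - A) E y)" by (intro card_mono finite_neighbors) auto
    also have "\<dots> \<le> 1" by (rule one) simp
    finally have "card {u, y'} \<le> 1" .
    then show ?thesis by (cases "u = y'") auto
  qed
  let ?A = "insert y A"
  have frag: "fragment ?A x y'"
  proof (rule fragmentI)
    \<comment> \<open>An empty far side would leave \<open>y'\<close> with no neighbors but
      \<open>x\<close> and \<open>y\<close>.\<close>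
    show "V - ?A - {x, y'} \<noteq> {}"
    proof
      assume none: "V - ?A - {x, y'} = {}"
      have "neighbors V E y' \<subseteq> {x, y}"
      proof
        fix u assume "u \<in> neighbors V E y'"
        then have u: "u \<in> V" "E y' u" by (auto simp: neighbors_def)
        have "u \<notin> A" using A'(10)[of u y'] u y' by auto
        moreover have "u \<noteq> y'" using u E_irrefl by auto
        ultimately show "u \<in> {x, y}" using none u by blast
      qed
      then show False using degree_gt_2[of y' x y] y' by blast
    qed
    fix u v assume *: "u \<in> ?A" "v \<in> V" "v \<notin> ?A" "v \<noteq> x" "v \<noteq> y'"
    then show "\<not> E u v" using A'(9)[of u v] yn[of v] by auto
  qed (use A' y' in auto)
  have "neighbors ?A E y' \<subseteq> {y}"
  proof
    fix u assume "u \<in> neighbors ?A E y'"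
    then show "u \<in> {y}" using A'(10)[of u y'] y' by (auto simp: neighbors_def)
  qed
  then have "card (neighbors ?A E y') \<le> card {y}" by (intro card_mono) auto
  then have small1: "Suc (card (neighbors ?A E y')) < k" using k_ge_3 by simp
  have "neighbors (V - ?A - {x, y'}) E x \<subseteq> neighbors (V - A) E x" by (auto simp: neighbors_def)
  then have "card (neighbors (V - ?A - {x, y'}) E x) \<le> card (neighbors (V - A) E x)"
    by (intro card_mono finite_neighbors) auto
  also have "\<dots> \<le> 1" by (rule one) simp
  finally have small2: "Suc (card (neighbors (V - ?A - {x, y'}) E x)) < k" using k_ge_3 by linarith
  show ?thesis
    by (rule kempe_connected_constant_unbalanced[OF frag const]) (use small1 small2 in auto)
qed

lemma kempe_connected_if_fragment:
  assumes A: "fragment A x y"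
  shows "kempe_connected V E L"
proof (cases "\<exists>u\<in>V. \<exists>v\<in>V. L u \<noteq> L v")
  case False
  then have const: "L v = L x" if "v \<in> V" for v using that fragmentD(3)[OF A] by blast
  \<comment> \<open>If one of the two degree conditions of the unbalanced case fails, for
    \<open>A\<close> or for its complement, then that side satisfies the balanced
    hypotheses.\<close>
  have "kempe_connected V E L" if "k \<le> Suc (card (neighbors S E x))" "k \<le> Suc (card (neighbors S E y))"
    "fragment S x y" for S
    using kempe_connected_constant_balanced[OF that(3) const that(1,2)] .
  then show ?thesis
    using kempe_connected_constant_unbalanced[OF A const] A fragment_compl[OF A] by (meson linorder_not_le)
next
  case True
  then obtain u0 v0 where uv0: "u0 \<in> V" "v0 \<in> V" "L u0 \<noteq> L v0" by blast
  obtain W x1 y1 where W: "minimal_fragment W x1 y1" using minimal_fragment_exists[OF A] by blast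
  note W' = fragmentD[OF minimal_fragmentD(1)[OF W]]
  obtain W2 x2 y2 where W2: "minimal_fragment W2 x2 y2" "W2 \<subseteq> V - W - {x1, y1}"
    using minimal_fragment_exists[OF fragment_compl[OF minimal_fragmentD(1)[OF W]]] by blast
  have const_case: "kempe_connected V E L"
    if S: "minimal_fragment S p q" and cs: "\<And>v w. v \<in> S \<union> {p, q} \<Longrightarrow> w \<in> S \<union> {p, q} \<Longrightarrow> L v = L w" for S p q
  proof -
    have const: "L v = L p" if "v \<in> S \<union> {p, q}" for v using cs[OF that, of p] by blast
    note S' = fragmentD[OF minimal_fragmentD(1)[OF S]]
    have "\<exists>u\<in>V. \<exists>v\<in>V. E u v \<and> L u \<noteq> L v"
    proof (rule ccontr)
      assume no: "\<not> ?thesis"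
      \<comment> \<open>Connectedness is given only after the deletion of a vertex, so
        \<open>q\<close> is deleted and treated apart.\<close>
      have eq: "L w = L p" if w: "w \<in> V" for w
      proof (cases "w = q")
        case True then show ?thesis using const by blast
      next
        case False
        then have "reach (V - {q}) E p w" using w S' by (intro no_cutvertex) auto
        then have "w \<in> {w. L w = L p}" by (rule reach_stays) (use no in auto)
        then show ?thesis by simp
      qed
      then show False using eq[OF uv0(1)] eq[OF uv0(2)] uv0(3) by simp
    qed
    then obtain u v where uv: "u \<in> V" "v \<in> V" "E u v" "L u \<noteq> L v" by blast
    obtain c where "c \<in> L u" "c \<notin> L v" using lists_differ[OF uv(1,2,4)] by blast
    then have g: "good u c" using uv by (auto simp: good_def)
    show ?thesis
      using kempe_connected_constant_fragment_split[OF S const g]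
        kempe_connected_constant_fragment_rigid[OF minimal_fragmentD(1)[OF S] const g] by blast
  qed
  show ?thesis
  proof (cases "(\<forall>v\<in>W \<union> {x1, y1}. \<forall>w\<in>W \<union> {x1, y1}. L v = L w) \<or> (\<forall>v\<in>W2 \<union> {x2, y2}. \<forall>w\<in>W2 \<union> {x2, y2}. L v = L w)")
    case True
    then show ?thesis
    proof
      assume "\<forall>v\<in>W \<union> {x1, y1}. \<forall>w\<in>W \<union> {x1, y1}. L v = L w"
      then show ?thesis by (intro const_case[OF W]) blast
    next
      assume "\<forall>v\<in>W2 \<union> {x2, y2}. \<forall>w\<in>W2 \<union> {x2, y2}. L v = L w"
      then show ?thesis by (intro const_case[OF W2(1)]) blast
    qed
  next
    case False
    then obtain p q p2 q2 where pq: "p \<in> W \<union> {x1, y1}" "q \<in> W \<union> {x1, y1}" "L p \<noteq> L q"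
      "p2 \<in> W2 \<union> {x2, y2}" "q2 \<in> W2 \<union> {x2, y2}" "L p2 \<noteq> L q2" by blast
    obtain v1 w1 where e1: "v1 \<in> W" "w1 \<in> W \<union> {x1, y1}" "E v1 w1" "L v1 \<noteq> L w1"
      using minimal_fragment_differing_edge[OF W pq(1-3)] by blast
    obtain v2 w2 where e2: "v2 \<in> W2" "w2 \<in> W2 \<union> {x2, y2}" "E v2 w2" "L v2 \<noteq> L w2"
      using minimal_fragment_differing_edge[OF W2(1) pq(4-6)] by blast
    have "W2 \<inter> (W \<union> {x1, y1}) = {}" using W2(2) by blast
    then show ?thesis by (rule kempe_connected_two_varying_fragments[OF W W2(1) _ e1 e2])
  qed
qed

end

section \<open>Transfer to digraphs\<close>

lemma dominates_induce_subgraph_iff: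
  "u \<rightarrow>\<^bsub>G \<restriction> S\<^esub> v \<longleftrightarrow> u \<in> S \<and> v \<in> S \<and> u \<rightarrow>\<^bsub>G\<^esub> v"
  by (auto simp: arcs_ends_def arc_to_ends_def)

text \<open>The conjunct \<open>u \<in> S\<close> reflects that \<open>reach\<close> is reflexive
  everywhere, whereas reachability in a digraph is so only on its vertices.\<close>

lemma reachable_induce_subgraph_iff:
  "u \<rightarrow>\<^sup>*\<^bsub>G \<restriction> S\<^esub> v \<longleftrightarrow> u \<in> S \<and> reach S (dominates G) u v"
proof
  assume "u \<rightarrow>\<^sup>*\<^bsub>G \<restriction> S\<^esub> v"
  then have "(u, v) \<in> rtrancl_on S (arcs_ends (G \<restriction> S))" by (simp add: reachable_def)
  then show "u \<in> S \<and> reach S (dominates G) u v"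
  proof (induction rule: rtrancl_on_induct)
    case (step v w)
    then have "v \<in> S \<and> w \<in> S \<and> v \<rightarrow>\<^bsub>G\<^esub> w" by (simp add: dominates_induce_subgraph_iff)
    then show ?case using step by (auto intro: rtranclp.rtrancl_into_rtrancl)
  qed simp
next
  assume *: "u \<in> S \<and> reach S (dominates G) u v"
  then have "reach S (dominates G) u v" by blast
  then have "(u, v) \<in> rtrancl_on S (arcs_ends (G \<restriction> S))"
  proof (induction rule: rtranclp_induct)
    case base
    then show ?case using * by (auto intro: rtrancl_on_refl)
  next
    case (step v w)
    then have "v \<rightarrow>\<^bsub>G \<restriction> S\<^esub> w" by (simp add: dominates_induce_subgraph_iff)
    then show ?case using step by (auto intro: rtrancl_on_into_rtrancl_on)
  qed
  then show "u \<rightarrow>\<^sup>*\<^bsub>G \<restriction> S\<^esub> v" by (simp add: reachable_def)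
qed

context graph
begin

lemma symp_dominates: "symp (dominates G)"
  using sym_arcs by (auto intro: sympI dest: arcs_ends_symmetric)

lemma irreflp_dominates: "irreflp (dominates G)"
  using adj_not_same by (auto intro: irreflpI)

lemma connected_induce_subgraph_iff:
  "connected (G \<restriction> S) \<longleftrightarrow> S \<noteq> {} \<and> (\<forall>u\<in>S. \<forall>v\<in>S. reach S (dominates G) u v)"
proof -
  interpret S: wf_digraph "G \<restriction> S" by auto
  have sym: "symmetric (G \<restriction> S)"
    unfolding symmetric_def
    by (rule symI) (use sympD[OF symp_dominates] in \<open>simp add: dominates_induce_subgraph_iff\<close>)
  have "u \<rightarrow>\<^sup>*\<^bsub>mk_symmetric (G \<restriction> S)\<^esub> v \<longleftrightarrow> u \<in> S \<and> reach S (dominates G) u v" for u v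
    by (simp only: S.reachable_mk_symmetric_eq[OF sym] reachable_induce_subgraph_iff)
  then show ?thesis unfolding connected_def strongly_connected_def by auto
qed

lemma out_degree_eq_card_neighbors: "out_degree G v = card (neighbors (verts G) (dominates G) v)"
proof -
  have "inj_on (head G) (out_arcs G v)"
    by (rule inj_onI) (auto intro: no_multi_arcs simp: arc_to_ends_def)
  moreover have "head G ` out_arcs G v = neighbors (verts G) (dominates G) v"
    by (auto simp: neighbors_def arcs_ends_conv)
  ultimately show ?thesis unfolding out_degree_def by (metis card_image)
qed

lemma list_coloring_iff:
  "list_coloring G L \<phi> \<longleftrightarrow> \<phi> \<in> extensional (verts G) \<and> coloring (verts G) (dominates G) L \<phi>"
  unfolding list_coloring_def coloring_def PiE_iff using adj_in_verts by blast

text \<open>The components that make up \<open>T\<close> are exchanged one at a time. Swapping one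
  of them leaves the rest closed and lowers the number of vertices still to be swapped; each
  intermediate coloring is valid because the lists concerned contain both colors.\<close>

lemma list_equivalent_swap_on:
  assumes "list_coloring G L \<phi>" "kempe_closed (verts G) (dominates G) \<phi> a b T"
    and "\<And>v. v \<in> T \<Longrightarrow> \<phi> v \<in> {a, b} \<Longrightarrow> a \<in> L v \<and> b \<in> L v"
  shows "list_equivalent G L \<phi> (swap_on a b T \<phi>)"
  using assms
proof (induction "card {v \<in> T. \<phi> v \<in> {a, b}}" arbitrary: T \<phi> rule: less_induct)
  case less
  let ?V = "verts G" and ?E = "dominates G"
  have \<phi>: "\<phi> \<in> extensional ?V" "coloring ?V ?E L \<phi>" using less.prems(1) by (auto simp: list_coloring_iff)
  have TV: "T \<subseteq> ?V" using kempe_closedD(1)[OF less.prems(2)] .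
  show ?case
  proof (cases "a = b \<or> {v \<in> T. \<phi> v \<in> {a, b}} = {}")
    case True
    then have "swap_on a b T \<phi> = \<phi>" by (auto simp: swap_on_def transpose_def fun_eq_iff)
    then show ?thesis by (simp add: list_equivalent_def)
  next
    case False
    then obtain u where u: "a \<noteq> b" "u \<in> T" "\<phi> u \<in> {a, b}" by blast
    let ?U = "{w \<in> ?V. \<phi> w = a \<or> \<phi> w = b}"
    define K where "K = kempe_component G \<phi> a b u"
    have K_iff: "v \<in> K \<longleftrightarrow> reach ?U ?E u v" for v
      using u TV by (auto simp: K_def kempe_component_def reachable_induce_subgraph_iff)
    have KT: "K \<subseteq> T \<inter> ?U"
    proof
      fix v assume "v \<in> K"
      then have "reach ?U ?E u v" by (simp add: K_iff)
      then show "v \<in> T \<inter> ?U"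
        by (rule reach_stays) (use u TV kempe_closedD(2)[OF less.prems(2)] in auto)
    qed
    have clK: "kempe_closed ?V ?E \<phi> a b K"
    proof (rule kempe_closedI)
      fix v w assume "v \<in> K" "w \<in> ?V" "v \<rightarrow> w" "\<phi> w \<in> {a, b}"
      then show "w \<in> K" using KT rtranclp.rtrancl_into_rtrancl[of "\<lambda>u v. u \<in> ?U \<and> v \<in> ?U \<and> ?E u v" u v w]
        by (auto simp: K_iff)
    qed (use KT TV in auto)
    let ?\<psi> = "swap_on a b K \<phi>"
    have \<psi>: "list_coloring G L ?\<psi>"
      unfolding list_coloring_iff
    proof
      show "coloring ?V ?E L ?\<psi>"
        by (rule coloring_swap_on[OF symp_dominates \<phi>(2) clK]) (use KT less.prems(3) in blast)
      show "?\<psi> \<in> extensional ?V" using \<phi>(1) KT TV by (auto simp: extensional_def swap_on_def)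
    qed
    have "?\<psi> = kempe_swap G a b u \<phi>" by (simp add: kempe_swap_def swap_on_def K_def)
    then have step: "valid_kempe_step G L \<phi> ?\<psi>"
      unfolding valid_kempe_step_def using less.prems(1) \<psi> u TV by blast
    have in_pair: "?\<psi> v \<in> {a, b} \<longleftrightarrow> \<phi> v \<in> {a, b}" for v by (rule swap_on_in_pair_iff)
    have clT: "kempe_closed ?V ?E ?\<psi> a b (T - K)"
    proof (rule kempe_closedI)
      fix v w assume *: "v \<in> T - K" "w \<in> ?V" "v \<rightarrow> w" "?\<psi> v \<in> {a, b}" "?\<psi> w \<in> {a, b}"
      then have p: "\<phi> v \<in> {a, b}" "\<phi> w \<in> {a, b}" by (simp_all only: in_pair)
      have "w \<in> T" using kempe_closedD(2)[OF less.prems(2), of v w] * p by blast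
      moreover have "w \<notin> K"
        using kempe_closedD(2)[OF clK, of w v] sympD[OF symp_dominates *(3)] * p TV by blast
      ultimately show "w \<in> T - K" by blast
    qed (use TV in auto)
    have "u \<in> K" by (simp add: K_iff)
    have "{v \<in> T - K. ?\<psi> v \<in> {a, b}} \<subset> {v \<in> T. \<phi> v \<in> {a, b}}"
      unfolding in_pair using u \<open>u \<in> K\<close> by blast
    moreover have "finite {v \<in> T. \<phi> v \<in> {a, b}}" using finite_subset[OF TV] finite_verts by simp
    ultimately have "card {v \<in> T - K. ?\<psi> v \<in> {a, b}} < card {v \<in> T. \<phi> v \<in> {a, b}}"
      by (intro psubset_card_mono)
    then have "list_equivalent G L ?\<psi> (swap_on a b (T - K) ?\<psi>)"
      by (rule less.hyps[OF _ \<psi> clT]) (use less.prems(3) in \<open>simp only: in_pair; blast\<close>)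
    moreover have "swap_on a b (T - K) ?\<psi> = swap_on a b T \<phi>"
      using KT by (auto simp: swap_on_def fun_eq_iff)
    ultimately show ?thesis
      using step unfolding list_equivalent_def by (metis converse_rtranclp_into_rtranclp)
  qed
qed

text \<open>Steps identify colorings that agree on the vertices; restriction picks the extensional
  representative required by \<open>list_coloring\<close>.\<close>

lemma list_equivalent_if_kempe_equiv:
  assumes "kempe_equiv (verts G) (dominates G) L \<phi> \<psi>"
  shows "list_equivalent G L (restrict \<phi> (verts G)) (restrict \<psi> (verts G))"
  using assms
proof (induction rule: rtranclp_induct)
  case base
  then show ?case by (simp add: list_equivalent_def)
next
  case (step \<psi> \<chi>)
  let ?V = "verts G" and ?E = "dominates G"
  from step(2) have "list_equivalent G L (restrict \<psi> ?V) (restrict \<chi> ?V)"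
  proof (elim kempe_stepE)
    fix a b T
    assume T: "coloring ?V ?E L \<psi>" "kempe_closed ?V ?E \<psi> a b T" "T \<subseteq> ?V"
      "\<And>v. v \<in> ?V \<Longrightarrow> \<chi> v = swap_on a b T \<psi> v"
      "\<And>v. v \<in> T \<Longrightarrow> \<psi> v \<in> {a, b} \<Longrightarrow> a \<in> L v \<and> b \<in> L v"
    have "list_coloring G L (restrict \<psi> ?V)" using T(1) by (auto simp: list_coloring_iff coloring_def)
    moreover have "kempe_closed ?V ?E (restrict \<psi> ?V) a b T"
    proof (rule kempe_closedI[OF T(3)])
      fix u v assume *: "u \<in> T" "v \<in> ?V" "u \<rightarrow> v" "restrict \<psi> ?V u \<in> {a, b}" "restrict \<psi> ?V v \<in> {a, b}"
      then have "\<psi> u \<in> {a, b}" "\<psi> v \<in> {a, b}" using T(3) by (auto simp: restrict_def split: if_splits)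
      then show "v \<in> T" using kempe_closedD(2)[OF T(2), of u v] * by blast
    qed
    moreover have "a \<in> L v \<and> b \<in> L v" if "v \<in> T" "restrict \<psi> ?V v \<in> {a, b}" for v
      using T(5)[of v] T(3) that by auto
    ultimately have "list_equivalent G L (restrict \<psi> ?V) (swap_on a b T (restrict \<psi> ?V))"
      by (rule list_equivalent_swap_on)
    moreover have "swap_on a b T (restrict \<psi> ?V) = restrict \<chi> ?V"
      using T(3,4) by (auto simp: swap_on_def fun_eq_iff)
    ultimately show ?thesis by simp
  qed
  then show ?case using step.IH unfolding list_equivalent_def by (meson rtranclp_trans)
qed

lemma list_swappable_if_kempe_connected:
  assumes "kempe_connected (verts G) (dominates G) L"
  shows "list_swappable G L"
proof -
  have "list_coloring G L (restrict \<phi> (verts G))" if "coloring (verts G) (dominates G) L \<phi>" for \<phi>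
    using that by (auto simp: list_coloring_iff coloring_def)
  moreover have "list_equivalent G L \<phi> \<psi>" if "list_coloring G L \<phi>" "list_coloring G L \<psi>" for \<phi> \<psi>
  proof -
    have "kempe_equiv (verts G) (dominates G) L \<phi> \<psi>"
      using that assms by (auto simp: list_coloring_iff kempe_connected_def)
    moreover have "restrict \<phi> (verts G) = \<phi>" "restrict \<psi> (verts G) = \<psi>"
      using that by (auto simp: list_coloring_iff extensional_restrict)
    ultimately show ?thesis using list_equivalent_if_kempe_equiv by metis
  qed
  ultimately show ?thesis using assms unfolding list_swappable_def kempe_connected_def by blast
qed

section \<open>From connectivity 2 to a fragment\<close>

lemma vertex_connectivity_2D:
  assumes "vertex_connectivity G = 2"
  shows "\<exists>S\<subseteq>verts G. card S = 2 \<and> (\<not> connected (G \<restriction> (verts G - S)) \<or> card (verts G - S) = 1)"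
    and "s \<in> verts G \<Longrightarrow> connected (G \<restriction> (verts G - {s}))"
proof -
  define P where "P = (\<lambda>n. \<exists>S\<subseteq>verts G. card S = n \<and>
     (\<not> connected (G \<restriction> (verts G - S)) \<or> card (verts G - S) = 1))"
  have least: "(LEAST n. P n) = 2" using assms by (simp add: vertex_connectivity_def P_def)
  \<comment> \<open>The \<open>LEAST\<close> is attained: deleting all vertices leaves the empty
    graph, which does not count as connected.\<close>
  have "\<not> connected (G \<restriction> (verts G - verts G))" by (simp add: connected_induce_subgraph_iff)
  then have "P (card (verts G))" unfolding P_def by blast
  then have "P 2" using LeastI[of P] least by metis
  then show "\<exists>S\<subseteq>verts G. card S = 2 \<and> (\<not> connected (G \<restriction> (verts G - S)) \<or> card (verts G - S) = 1)"
    unfolding P_def .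
  have "\<not> P 1" using not_less_Least[of 1 P] least by simp
  then show "connected (G \<restriction> (verts G - {s}))" if "s \<in> verts G"
    using that unfolding P_def by (metis card_1_singleton_iff empty_subsetI insert_subset One_nat_def)
qed

lemma regular_connectivity_2:
  assumes "k \<ge> 3" "regular k G" "vertex_connectivity G = 2"
  shows "biconnected_regular (verts G) (dominates G) k"
    and "\<exists>A x y. biconnected_regular.fragment (verts G) (dominates G) A x y"
proof -
  let ?V = "verts G" and ?E = "dominates G"
  show br: "biconnected_regular ?V ?E k"
  proof
    show "finite ?V" by (rule finite_verts)
    show "card (neighbors ?V ?E v) = k" if "v \<in> ?V" for v
      using assms(2) that by (simp add: regular_def out_degree_eq_card_neighbors)
    show "reach (?V - {s}) ?E u v" if "s \<in> ?V" "u \<in> ?V - {s}" "v \<in> ?V - {s}" for s u v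
      using vertex_connectivity_2D(2)[OF assms(3) that(1)] that by (simp add: connected_induce_subgraph_iff)
  qed (use symp_dominates irreflp_dominates assms(1) in auto)
  interpret biconnected_regular ?V ?E k by (rule br)
  obtain S where S: "S \<subseteq> ?V" "card S = 2" "\<not> connected (G \<restriction> (?V - S)) \<or> card (?V - S) = 1"
    using vertex_connectivity_2D(1)[OF assms(3)] by blast
  obtain x y where xy: "S = {x, y}" "x \<noteq> y" using S(2) by (auto simp: card_2_iff)
  \<comment> \<open>A vertex of \<open>S\<close> has at least two neighbors outside
    \<open>S\<close>, so only disconnectedness of a nonempty rest remains possible.\<close>
  have "card (?V - S) \<noteq> 1" "?V - S \<noteq> {}"
  proof -
    have "neighbors ?V ?E x \<subseteq> insert y (?V - S)"
      using xy E_irrefl by (auto simp: neighbors_def)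
    then have "card (neighbors ?V ?E x) \<le> card (insert y (?V - S))"
      using finite_verts by (intro card_mono) auto
    also have "\<dots> \<le> Suc (card (?V - S))" by (simp add: card_insert_if)
    finally have ge: "2 \<le> card (?V - S)" using degree[of x] S(1) xy assms(1) by auto
    then show "card (?V - S) \<noteq> 1" by simp
    show "?V - S \<noteq> {}"
    proof
      assume "?V - S = {}"
      then show False using ge by (simp only: card.empty)
    qed
  qed
  then obtain u v where uv: "u \<in> ?V - S" "v \<in> ?V - S" "\<not> reach (?V - S) ?E u v"
    using S(3) unfolding connected_induce_subgraph_iff by blast
  let ?A = "{z \<in> ?V - S. reach (?V - S) ?E u z}"
  have "fragment ?A x y"
  proof (rule fragmentI)
    show "?A \<noteq> {}" using uv(1) by blast
    show "?V - ?A - {x, y} \<noteq> {}" using uv(2,3) xy by blast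
    fix a z assume *: "a \<in> ?A" "z \<in> ?V" "z \<notin> ?A" "z \<noteq> x" "z \<noteq> y"
    show "\<not> a \<rightarrow> z"
    proof
      assume "a \<rightarrow> z"
      then have "reach (?V - S) ?E u z"
        using * xy by (intro rtranclp.rtrancl_into_rtrancl[of _ u a z]) auto
      then show False using * xy by blast
    qed
  qed (use S(1) xy in auto)
  then show "\<exists>A x y. fragment A x y" by blast
qed

end

theorem theorem2:
  fixes G :: "('a, 'b) pre_digraph" and k :: nat
  assumes "k \<ge> 3"
    and "graph G"
    and "regular k G"
    and "vertex_connectivity G = 2"
  shows "swappable TYPE('c) k G"
  unfolding swappable_def
proof (intro allI impI)
  fix L :: "'a \<Rightarrow> 'c set"
  assume L: "list_assignment k G L"
  interpret graph G by (rule assms(2))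
  interpret biconnected_regular_lists "verts G" "dominates G" k L
    using regular_connectivity_2(1)[OF assms(1,3,4)] L
    by (auto simp: biconnected_regular_lists_def biconnected_regular_lists_axioms_def list_assignment_def)
  show "list_swappable G L"
    using regular_connectivity_2(2)[OF assms(1,3,4)] kempe_connected_if_fragment
      list_swappable_if_kempe_connected by blast
qed

end
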